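(* Let $n\ge2$ and let $\Omega=\Omega_0\setminus\overline{\Omega}_1\subseteq\mathbb{R}^n$ be a smooth bounded annular domain, different from a standard annulus, for which there are constants $a>0$, $c>0$ and a solution $u\in C^\infty(\overline{\Omega})$ of $$\begin{cases} -\Delta u = 1 & \text{in } \Omega,\\ u=0,\ \ \partial_\nu u = c & \text{on } \partial\Omega_0,\\ u=a,\ \ \partial_\nu u = c & \text{on } \partial\Omega_1.\end{cases}$$ Then $$h_1(\Omega)=\frac{P(\Omega)}{|\Omega|}=\frac1c$$ and $\Omega$ is the unique minimizer of the Cheeger problem $h_1(\Omega)=\inf\{P(E)/|E| : E\subseteq\Omega\}$.
   Context: Here $\Omega_0,\Omega_1$ are bounded (nonempty) domains in $\mathbb{R}^n$ with $\Omega_1\Subset\Omega_0$, and $\Omega=\Omega_0\setminus\overline{\Omega}_1$ is connected. $\nu$ is the inner unit normal to $\Omega$ along $\partial\Omega$. A standard annulus is a set $\{x: r<|x-x_0|<R\}$ with $0<r<R$. $|E|$ is the Lebesgue measure of $E$ and $P(E)$ its perimeter in $\mathbb{R}^n$ (in the sense of De Giorgi); the infimum in $h_1(\Omega)$ is over measurable $E\subseteq\Omega$ with $|E|>0$, and, as usual for sets of finite perimeter, sets are identified when they differ by a null set (so uniqueness of the minimizer is up to null sets). *)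

theory Defs
  imports "HOL-Analysis.Analysis"
begin

(* Intended for open S: all iterated directional derivatives up to order k exist and are
   continuous.  The derivatives are taken in the full space, hence only depend on f on S. *)
primrec Ck_on :: "nat \<Rightarrow> 'a::euclidean_space set \<Rightarrow> ('a \<Rightarrow> 'b::real_normed_vector) \<Rightarrow> bool" where
  "Ck_on 0 S f \<longleftrightarrow> continuous_on S f"
| "Ck_on (Suc k) S f \<longleftrightarrow>
     (\<forall>x\<in>S. f differentiable (at x)) \<and> (\<forall>v. Ck_on k S (\<lambda>x. frechet_derivative f (at x) v))"

definition smooth_on :: "'a::euclidean_space set \<Rightarrow> ('a \<Rightarrow> 'b::real_normed_vector) \<Rightarrow> bool" where
  "smooth_on S f \<longleftrightarrow> (\<forall>k. Ck_on k S f)"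

(* The class of C-infinity functions on the closure of an open set D, as restrictions of smooth
   functions on open neighbourhoods of the closure; for bounded D with smooth boundary this is the
   same as requiring that all derivatives extend continuously from D to its closure. *)
definition smooth_up_to_boundary ::
    "'a::euclidean_space set \<Rightarrow> ('a \<Rightarrow> 'b::real_normed_vector) \<Rightarrow> bool" where
  "smooth_up_to_boundary D u \<longleftrightarrow>
     (\<exists>U v. open U \<and> closure D \<subseteq> U \<and> smooth_on U v \<and> (\<forall>x\<in>closure D. u x = v x))"

definition laplacian :: "('a::euclidean_space \<Rightarrow> real) \<Rightarrow> 'a \<Rightarrow> real" where
  "laplacian f x =
     (\<Sum>b\<in>Basis. frechet_derivative (\<lambda>y. frechet_derivative f (at y) b) (at x) b)"

definition divergence :: "('a::euclidean_space \<Rightarrow> 'a) \<Rightarrow> 'a \<Rightarrow> real" where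
  "divergence \<phi> x = (\<Sum>b\<in>Basis. frechet_derivative \<phi> (at x) b \<bullet> b)"

definition boundary_chart ::
    "'a::euclidean_space set \<Rightarrow> 'a \<Rightarrow> 'a set \<Rightarrow> ('a \<Rightarrow> real) \<Rightarrow> bool" where
  "boundary_chart D x U \<rho> \<longleftrightarrow>
     open U \<and> x \<in> U \<and> smooth_on U \<rho> \<and> (\<forall>y\<in>U. \<exists>g. g \<noteq> 0 \<and> GDERIV \<rho> y :> g) \<and>
     D \<inter> U = {y \<in> U. \<rho> y > 0} \<and> frontier D \<inter> U = {y \<in> U. \<rho> y = 0}"

definition smooth_boundary :: "'a::euclidean_space set \<Rightarrow> bool" where
  "smooth_boundary D \<longleftrightarrow> (\<forall>x\<in>frontier D. \<exists>U \<rho>. boundary_chart D x U \<rho>)"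

(* The defining function is positive inside D, so its gradient points into D. *)
definition inner_unit_normal :: "'a::euclidean_space set \<Rightarrow> 'a \<Rightarrow> 'a \<Rightarrow> bool" where
  "inner_unit_normal D x \<nu> \<longleftrightarrow>
     x \<in> frontier D \<and> (\<exists>U \<rho> g. boundary_chart D x U \<rho> \<and> GDERIV \<rho> x :> g \<and> \<nu> = g /\<^sub>R norm g)"

(* One-sided, so that only values of u on the closure of D matter when \<nu> points into D. *)
definition has_directional_derivative ::
    "('a::euclidean_space \<Rightarrow> real) \<Rightarrow> 'a \<Rightarrow> 'a \<Rightarrow> real \<Rightarrow> bool" where
  "has_directional_derivative u x \<nu> d \<longleftrightarrow>
     ((\<lambda>t. u (x + t *\<^sub>R \<nu>)) has_real_derivative d) (at_right 0)"

definition standard_annulus :: "'a::euclidean_space set \<Rightarrow> bool" where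
  "standard_annulus A \<longleftrightarrow>
     (\<exists>x0 r R. 0 < r \<and> r < R \<and> A = {x. r < norm (x - x0) \<and> norm (x - x0) < R})"

definition test_field :: "('a::euclidean_space \<Rightarrow> 'a) \<Rightarrow> bool" where
  "test_field \<phi> \<longleftrightarrow>
     Ck_on 1 UNIV \<phi> \<and> compact (closure {x. \<phi> x \<noteq> 0}) \<and> (\<forall>x. norm (\<phi> x) \<le> 1)"

(* De Giorgi perimeter.  Truncation of negative integrals by ennreal does not affect the
   supremum, since the zero field is admissible. *)
definition perimeter :: "'a::euclidean_space set \<Rightarrow> ennreal" where
  "perimeter E = (SUP \<phi> \<in> Collect test_field. ennreal (LINT x:E|lebesgue. divergence \<phi> x))"

definition cheeger_admissible :: "'a::euclidean_space set \<Rightarrow> 'a set \<Rightarrow> bool" where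
  "cheeger_admissible D E \<longleftrightarrow> E \<in> sets lebesgue \<and> E \<subseteq> D \<and> emeasure lebesgue E > 0"

definition cheeger_constant :: "'a::euclidean_space set \<Rightarrow> ennreal" where
  "cheeger_constant D =
     (INF E \<in> Collect (cheeger_admissible D). perimeter E / emeasure lebesgue E)"

definition cheeger_minimizer :: "'a::euclidean_space set \<Rightarrow> 'a set \<Rightarrow> bool" where
  "cheeger_minimizer D E \<longleftrightarrow>
     cheeger_admissible D E \<and> perimeter E / emeasure lebesgue E = cheeger_constant D"

end

theory Submission
  imports Defs
begin

text \<open>
The field \<open>\<nabla>u\<close> calibrates \<open>\<Omega>\<close>. Since \<open>\<Delta>u = -1\<close>, its squared length satisfies
\<open>\<Delta>|\<nabla>u|\<^sup>2 = 2|D\<^sup>2u|\<^sup>2 > 0\<close>, so \<open>|\<nabla>u|\<close> can attain its maximum over the closure of \<open>\<Omega>\<close> only on the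
boundary. There \<open>u\<close> is locally constant along the boundary, hence \<open>\<nabla>u = c\<nu>\<close>. Therefore
\<open>|\<nabla>u| < c\<close> inside \<open>\<Omega>\<close> (\<open>norm_grad_less_boundary_value\<close>), and \<open>-\<nabla>u/c\<close> is a field of length at most
one and divergence \<open>1/c\<close>. Cut off slightly outside \<open>\<Omega>\<close> and rescaled, it is a competitor in
De Giorgi's supremum for every measurable \<open>E \<subseteq> \<Omega>\<close>, which gives \<open>|E|/c \<le> P(E)\<close>
(\<open>calibration_le_perimeter\<close>).

For \<open>E = \<Omega>\<close> the bound is attained because \<open>\<nabla>u\<close> is normal to the boundary with length exactly \<open>c\<close>.
This is a case of the divergence theorem, obtained here by integrating over thin layers at the boundary:
the indicator of \<open>\<Omega>\<close> is approximated by functions \<open>w\<close> of the distance-like quantity \<open>g\<close>, which is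
\<open>u\<close> near the outer and \<open>u - a\<close> near the inner boundary, so that \<open>\<nabla>w\<close> is a nonnegative multiple of \<open>\<nabla>u\<close>
and is concentrated where \<open>|\<nabla>u|\<close> is close to \<open>c\<close>. For a test field \<open>\<phi>\<close>, \<open>-\<nabla>w \<cdot> \<phi>\<close> is at most \<open>\<nabla>w \<cdot> \<nabla>u/b\<close> for any
\<open>b < c\<close>, and integrating by parts on both sides yields \<open>P(\<Omega>) \<le> |\<Omega>|/c\<close> (\<open>perimeter_le_calibrated\<close>).
The only integration by parts used is that the divergence of a compactly supported field integrates
to zero, a consequence of translation invariance.

For uniqueness let \<open>P(E) = |E|/c\<close>. Since \<open>|\<nabla>u| < c\<close> inside, the calibration stays admissible
when a small multiple of any compactly supported field \<open>\<psi>\<close> in \<open>\<Omega>\<close> is added to it, with either sign.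
As the lower bound is sharp for \<open>E\<close>, the integral of \<open>div \<psi>\<close> over \<open>E\<close> must vanish
(\<open>weakly_constant_on_if_perimeter_le\<close>). So the indicator of \<open>E\<close> has zero weak gradient in the
connected set \<open>\<Omega>\<close> and is constant almost everywhere (\<open>weakly_constant_on_connected\<close>); as
\<open>|E| > 0\<close>, the set \<open>E\<close> fills \<open>\<Omega>\<close> up to a null set.
\<close>

section \<open>Continuously differentiable functions and cutoffs\<close>

abbreviation fd :: "('a::euclidean_space \<Rightarrow> 'b::real_normed_vector) \<Rightarrow> 'a \<Rightarrow> 'a \<Rightarrow> 'b" where
  "fd f x \<equiv> frechet_derivative f (at x)"

lemma fd_eqI: "(f has_derivative f') (at x) \<Longrightarrow> fd f x = f'"
  by (metis frechet_derivative_at)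

lemma fd_cong_open:
  assumes "open S" "x \<in> S" "\<And>y. y \<in> S \<Longrightarrow> f y = g y"
  shows "fd f x = fd g x"
proof -
  have "(f has_derivative f') (at x) \<longleftrightarrow> (g has_derivative f') (at x)" for f'
    using has_derivative_transform_within_open[OF _ assms(1,2)] assms(3) by metis
  then show ?thesis unfolding frechet_derivative_def by simp
qed

text \<open>A constant of its own, so that simplification does not rewrite \<open>Ck_on 1\<close> by the recursion equations
and lemmas about class \<open>C\<^sup>1\<close> remain applicable.\<close>
definition C1_on :: "'a::euclidean_space set \<Rightarrow> ('a \<Rightarrow> 'b::real_normed_vector) \<Rightarrow> bool" where
  "C1_on S f \<longleftrightarrow> Ck_on 1 S f"

lemma C1_on_iff:
  "C1_on S f \<longleftrightarrow> (\<forall>x\<in>S. f differentiable at x) \<and> (\<forall>v. continuous_on S (\<lambda>x. fd f x v))"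
  by (simp only: C1_on_def One_nat_def Ck_on.simps)

lemma C1_onI:
  assumes f': "\<And>x. x \<in> S \<Longrightarrow> (f has_derivative f' x) (at x)" and c: "\<And>v. continuous_on S (\<lambda>x. f' x v)"
  shows "C1_on S f"
  unfolding C1_on_iff
proof (intro conjI ballI allI)
  show "f differentiable at x" if "x \<in> S" for x
    using f'[OF that] by (rule differentiableI)
  show "continuous_on S (\<lambda>x. fd f x v)" for v
    by (rule continuous_on_eq[OF c]) (simp only: fd_eqI[OF f'])
qed

lemma C1_on_has_derivative: "C1_on S f \<Longrightarrow> x \<in> S \<Longrightarrow> (f has_derivative fd f x) (at x)"
  unfolding C1_on_iff by (simp only: frechet_derivative_works)

lemma C1_on_linear: "C1_on S f \<Longrightarrow> x \<in> S \<Longrightarrow> linear (fd f x)"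
  by (rule has_derivative_linear[OF C1_on_has_derivative])

lemma C1_on_continuous_fd: "C1_on S f \<Longrightarrow> continuous_on S (\<lambda>x. fd f x v)"
  unfolding C1_on_iff by blast

lemma C1_on_continuous: "C1_on S f \<Longrightarrow> continuous_on S f"
  by (intro continuous_at_imp_continuous_on ballI has_derivative_continuous[OF C1_on_has_derivative])

lemma C1_on_subset: "C1_on S f \<Longrightarrow> T \<subseteq> S \<Longrightarrow> C1_on T f"
  unfolding C1_on_iff using continuous_on_subset by blast

lemma fd_eq_sum_Basis:
  assumes "C1_on S f" "x \<in> S"
  shows "fd f x v = (\<Sum>b\<in>Basis. (v \<bullet> b) *\<^sub>R fd f x b)"
proof -
  interpret l: linear "fd f x" using C1_on_linear[OF assms] .
  have "fd f x v = fd f x (\<Sum>b\<in>Basis. (v \<bullet> b) *\<^sub>R b)" by (simp add: euclidean_representation)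
  also have "\<dots> = (\<Sum>b\<in>Basis. (v \<bullet> b) *\<^sub>R fd f x b)" by (simp add: l.sum l.scaleR)
  finally show ?thesis .
qed

lemma C1_on_cong:
  assumes "open S" "C1_on S f" "\<And>x. x \<in> S \<Longrightarrow> f x = g x"
  shows "C1_on S g"
proof (rule C1_onI)
  show "(g has_derivative fd f x) (at x)" if "x \<in> S" for x
    using has_derivative_transform_within_open[OF C1_on_has_derivative[OF assms(2) that] assms(1) that]
      assms(3) by metis
qed (rule C1_on_continuous_fd[OF assms(2)])

text \<open>Gluing: functions below are given by different formulas on overlapping open sets, and their
regularity is verified around each point separately.\<close>
lemma C1_on_locally:
  assumes "\<And>x. x \<in> S \<Longrightarrow> \<exists>T. open T \<and> x \<in> T \<and> C1_on T f"
  shows "C1_on S f"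
proof (rule C1_onI)
  show "(f has_derivative fd f x) (at x)" if "x \<in> S" for x
    using assms[OF that] C1_on_has_derivative by blast
  show "continuous_on S (\<lambda>x. fd f x v)" for v
  proof (rule continuous_at_imp_continuous_on, rule ballI)
    fix x assume "x \<in> S"
    from assms[OF this] obtain T where "open T" "x \<in> T" "C1_on T f" by blast
    then show "isCont (\<lambda>x. fd f x v) x"
      using C1_on_continuous_fd continuous_on_eq_continuous_at by blast
  qed
qed

lemma C1_on_const: "C1_on S (\<lambda>x. k)"
  by (rule C1_onI[where f'="\<lambda>_ _. 0"]) (auto intro: derivative_eq_intros)

lemma C1_on_scaleR:
  assumes g: "C1_on S g" and f: "C1_on S f"
  shows "C1_on S (\<lambda>x. g x *\<^sub>R f x)"
proof (rule C1_onI)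
  show "((\<lambda>x. g x *\<^sub>R f x) has_derivative (\<lambda>v. g x *\<^sub>R fd f x v + fd g x v *\<^sub>R f x)) (at x)"
    if "x \<in> S" for x
    by (rule has_derivative_scaleR[OF C1_on_has_derivative[OF g that] C1_on_has_derivative[OF f that]])
  show "continuous_on S (\<lambda>x. g x *\<^sub>R fd f x v + fd g x v *\<^sub>R f x)" for v
    by (intro continuous_on_add continuous_on_scaleR C1_on_continuous_fd[OF f] C1_on_continuous_fd[OF g]
        C1_on_continuous[OF f] C1_on_continuous[OF g])
qed

lemma C1_on_mult:
  fixes f g :: "'a::euclidean_space \<Rightarrow> real"
  assumes "C1_on S g" "C1_on S f"
  shows "C1_on S (\<lambda>x. g x * f x)"
  using C1_on_scaleR[OF assms] by simp

lemma C1_on_add: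
  assumes g: "C1_on S g" and f: "C1_on S f"
  shows "C1_on S (\<lambda>x. g x + f x)"
proof (rule C1_onI)
  show "((\<lambda>x. g x + f x) has_derivative (\<lambda>v. fd g x v + fd f x v)) (at x)" if "x \<in> S" for x
    by (rule has_derivative_add[OF C1_on_has_derivative[OF g that] C1_on_has_derivative[OF f that]])
  show "continuous_on S (\<lambda>x. fd g x v + fd f x v)" for v
    by (intro continuous_on_add C1_on_continuous_fd[OF f] C1_on_continuous_fd[OF g])
qed

lemma C1_on_scaleR_const:
  assumes "C1_on S f"
  shows "C1_on S (\<lambda>x. k *\<^sub>R f x)"
  by (rule C1_on_scaleR[OF C1_on_const assms])

lemma C1_on_diff:
  assumes "C1_on S g" "C1_on S f"
  shows "C1_on S (\<lambda>x. g x - f x)"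
  using C1_on_add[OF assms(1) C1_on_scaleR_const[OF assms(2), of "-1"]] by simp

lemma C1_on_sum:
  assumes "\<And>i. i \<in> I \<Longrightarrow> C1_on S (f i)"
  shows "C1_on S (\<lambda>x. \<Sum>i\<in>I. f i x)"
  using assms
proof (induction I rule: infinite_finite_induct)
  case (insert i I)
  then have "C1_on S (\<lambda>x. f i x + (\<Sum>i\<in>I. f i x))" by (intro C1_on_add) blast+
  then show ?case using insert by (simp only: sum.insert[OF insert(1,2)])
qed (simp_all add: C1_on_const)

lemma C1_on_compose:
  fixes g :: "'a::euclidean_space \<Rightarrow> real" and \<eta> :: "real \<Rightarrow> real"
  assumes "C1_on S g" "\<And>t. (\<eta> has_real_derivative \<eta>' t) (at t)" "continuous_on UNIV \<eta>'"
  shows "C1_on S (\<lambda>x. \<eta> (g x))"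
proof (rule C1_onI)
  show "((\<lambda>x. \<eta> (g x)) has_derivative (\<lambda>v. \<eta>' (g x) * fd g x v)) (at x)" if "x \<in> S" for x
    using has_derivative_compose[OF C1_on_has_derivative[OF assms(1) that]
        assms(2)[of "g x", unfolded has_field_derivative_def]] by simp
  have "continuous_on S (\<lambda>x. \<eta>' (g x))"
    using continuous_on_compose2[OF assms(3) C1_on_continuous[OF assms(1)]] by simp
  then show "continuous_on S (\<lambda>x. \<eta>' (g x) * fd g x v)" for v
    by (intro continuous_intros C1_on_continuous_fd assms(1))
qed

text \<open>The simplest function that vanishes exactly on a half-line and is continuously differentiable;
all cutoffs are composed from it, so that one derivative computation serves for all of them.\<close>
definition pos_square :: "real \<Rightarrow> real" where "pos_square t = (max 0 t)\<^sup>2"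

lemma pos_square_has_derivative: "(pos_square has_real_derivative 2 * max 0 t) (at t)"
proof -
  consider "t < 0" | "t > 0" | "t = 0" by linarith
  then show ?thesis
  proof cases
    case 1
    have "((\<lambda>t. 0) has_real_derivative 2 * max 0 t) (at t)" using 1 by simp
    then show ?thesis
      by (rule has_field_derivative_transform_within_open[of _ _ _ "{..<0}"])
        (use 1 in \<open>auto simp: pos_square_def\<close>)
  next
    case 2
    have "((\<lambda>t. t\<^sup>2) has_real_derivative 2 * max 0 t) (at t)"
      using 2 by (auto intro!: derivative_eq_intros)
    then show ?thesis
      by (rule has_field_derivative_transform_within_open[of _ _ _ "{0<..}"])
        (use 2 in \<open>auto simp: pos_square_def\<close>)
  next
    case 3
    have "((\<lambda>h. (pos_square (0 + h) - pos_square 0) / h) \<longlongrightarrow> 0) (at 0)"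
    proof (rule Lim_null_comparison)
      show "\<forall>\<^sub>F h in at 0. norm ((pos_square (0 + h) - pos_square 0) / h) \<le> \<bar>h\<bar>"
        by (rule always_eventually) (auto simp: pos_square_def power2_eq_square max_def field_simps)
      show "((\<lambda>h::real. \<bar>h\<bar>) \<longlongrightarrow> 0) (at 0)" by (auto intro!: tendsto_eq_intros)
    qed
    then show ?thesis using 3 by (simp add: DERIV_def)
  qed
qed

lemma continuous_pos_square_deriv: "continuous_on UNIV (\<lambda>t::real. 2 * max 0 t)"
  by (intro continuous_intros)

lemma C1_on_pos_square: "C1_on S g \<Longrightarrow> C1_on S (\<lambda>x. pos_square (g x))"
  by (rule C1_on_compose[OF _ pos_square_has_derivative continuous_pos_square_deriv])

text \<open>A nondecreasing step from 0 to 1 between the arguments 1 and 2, of class \<open>C\<^sup>1\<close>.\<close>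
definition smooth_step :: "real \<Rightarrow> real" where
  "smooth_step t = 1 - pos_square (1 - pos_square (t - 1))"

definition smooth_step' :: "real \<Rightarrow> real" where
  "smooth_step' t = (2 * max 0 (1 - pos_square (t - 1))) * (2 * max 0 (t - 1))"

lemma smooth_step_has_derivative: "(smooth_step has_real_derivative smooth_step' t) (at t)"
proof -
  have a: "((\<lambda>t. pos_square (t - 1)) has_real_derivative 2 * max 0 (t - 1)) (at t)"
    using DERIV_chain2[OF pos_square_has_derivative DERIV_diff[OF DERIV_ident DERIV_const]] by simp
  have "((\<lambda>t. 1 - pos_square (t - 1)) has_real_derivative 0 - 2 * max 0 (t - 1)) (at t)"
    by (intro DERIV_diff DERIV_const a)
  from DERIV_chain2[OF pos_square_has_derivative this]
  have "((\<lambda>t. pos_square (1 - pos_square (t - 1))) has_real_derivative 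
      2 * max 0 (1 - pos_square (t - 1)) * (0 - 2 * max 0 (t - 1))) (at t)" .
  from DERIV_diff[OF DERIV_const[of 1] this] show ?thesis
    unfolding smooth_step_def[abs_def] smooth_step'_def by (simp add: algebra_simps)
qed

lemma smooth_step'_nonneg: "smooth_step' t \<ge> 0"
  unfolding smooth_step'_def by (intro mult_nonneg_nonneg) auto

lemma continuous_smooth_step': "continuous_on UNIV smooth_step'"
proof -
  have "continuous_on UNIV pos_square"
    by (meson DERIV_isCont continuous_at_imp_continuous_on pos_square_has_derivative)
  then have "continuous_on UNIV (\<lambda>t. pos_square (t - 1))"
    by (rule continuous_on_compose2) (auto intro: continuous_intros)
  then show ?thesis unfolding smooth_step'_def[abs_def] by (intro continuous_intros)
qed

lemma smooth_step_0: "t \<le> 1 \<Longrightarrow> smooth_step t = 0"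
  by (simp add: smooth_step_def pos_square_def)

lemma smooth_step_1: "t \<ge> 2 \<Longrightarrow> smooth_step t = 1"
proof -
  assume "t \<ge> 2"
  then have "pos_square (t - 1) \<ge> 1" by (simp add: pos_square_def one_le_power)
  then show ?thesis by (simp add: smooth_step_def) (simp add: pos_square_def)
qed

lemma smooth_step_bounds: "0 \<le> smooth_step t" "smooth_step t \<le> 1"
proof -
  have "pos_square (t - 1) \<ge> 0" by (simp add: pos_square_def)
  then have "(max 0 (1 - pos_square (t - 1)))\<^sup>2 \<le> 1" by (intro power_le_one) auto
  then show "0 \<le> smooth_step t" "smooth_step t \<le> 1" by (auto simp: smooth_step_def pos_square_def)
qed

lemma C1_on_smooth_step: "C1_on S g \<Longrightarrow> C1_on S (\<lambda>x. smooth_step (g x))"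
  by (rule C1_on_compose[OF _ smooth_step_has_derivative continuous_smooth_step'])

lemma C1_on_dist_square: "C1_on S (\<lambda>x. (norm (x - a))\<^sup>2 :: real)"
proof -
  have "C1_on S (\<lambda>x. \<Sum>b\<in>Basis. ((x - a) \<bullet> b) * ((x - a) \<bullet> b))"
  proof (intro C1_on_sum C1_on_mult)
    show "C1_on S (\<lambda>x. (x - a) \<bullet> b)" for b
      by (rule C1_onI[where f'="\<lambda>_ v. v \<bullet> b"]) (auto intro!: derivative_eq_intros)
    then show "C1_on S (\<lambda>x. (x - a) \<bullet> b)" for b .
  qed
  moreover have "(norm (x - a))\<^sup>2 = (\<Sum>b\<in>Basis. ((x - a) \<bullet> b) * ((x - a) \<bullet> b))" for x
    by (simp add: power2_norm_eq_inner euclidean_inner[of "x - a" "x - a"])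
  ultimately show ?thesis by presburger
qed

text \<open>Around each point of \<open>K\<close> the function \<open>pos_square (r\<^sup>2 - |x - y|\<^sup>2)\<close> is positive on a small ball in
\<open>V\<close> and zero outside. By compactness finitely many of them have a sum that is bounded below by a
positive \<open>\<delta>\<close> on \<open>K\<close>; a step function then levels this sum to 1 on \<open>K\<close>.\<close>
lemma C1_cutoff:
  fixes K :: "'a::euclidean_space set"
  assumes "compact K" "open V" "K \<subseteq> V"
  obtains \<kappa> :: "'a \<Rightarrow> real" where "C1_on UNIV \<kappa>" "\<And>x. 0 \<le> \<kappa> x" "\<And>x. \<kappa> x \<le> 1"
    "\<And>x. x \<in> K \<Longrightarrow> \<kappa> x = 1" "compact (closure {x. \<kappa> x \<noteq> 0})" "closure {x. \<kappa> x \<noteq> 0} \<subseteq> V"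
proof -
  have "\<exists>r>0. cball x r \<subseteq> V" if "x \<in> K" for x
    using assms(2,3) that open_contains_cball by (metis subsetD)
  then obtain r where r: "\<And>x. x \<in> K \<Longrightarrow> r x > 0 \<and> cball x (r x) \<subseteq> V" by metis
  have "K \<subseteq> (\<Union>x\<in>K. ball x (r x))" using r by force
  then obtain C where C: "C \<subseteq> K" "finite C" "K \<subseteq> (\<Union>x\<in>C. ball x (r x))"
    using compactE_image[OF assms(1), of K "\<lambda>x. ball x (r x)"] by auto
  define s where "s x = (\<Sum>y\<in>C. pos_square ((r y)\<^sup>2 - (norm (x - y))\<^sup>2))" for x
  have pos0: "pos_square t \<ge> 0" for t by (simp add: pos_square_def)
  have s0: "s x \<ge> 0" for x unfolding s_def by (intro sum_nonneg) (simp add: pos0)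
  have sC1: "C1_on UNIV s"
    unfolding s_def[abs_def] by (intro C1_on_sum C1_on_pos_square C1_on_diff C1_on_const C1_on_dist_square)
  have spos: "s x > 0" if xK: "x \<in> K" for x
  proof -
    obtain y where y: "y \<in> C" "x \<in> ball y (r y)" using C(3) xK by auto
    then have "norm (x - y) < r y" by (simp add: dist_norm norm_minus_commute)
    then have "(norm (x - y))\<^sup>2 < (r y)\<^sup>2" by (intro power_strict_mono) auto
    then have "pos_square ((r y)\<^sup>2 - (norm (x - y))\<^sup>2) > 0" by (simp add: pos_square_def)
    then show ?thesis unfolding s_def by (rule sum_pos2[OF C(2) y(1)]) (rule pos0)
  qed
  obtain \<delta> where \<delta>: "\<delta> > 0" "\<And>x. x \<in> K \<Longrightarrow> s x \<ge> \<delta>"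
  proof (cases "K = {}")
    case True then show ?thesis using that[of 1] by auto
  next
    case False
    obtain z where "z \<in> K" "\<And>y. y \<in> K \<Longrightarrow> s z \<le> s y"
      using continuous_attains_inf[OF assms(1) False continuous_on_subset[OF C1_on_continuous[OF sC1] subset_UNIV]]
      by blast
    then show ?thesis using that[of "s z"] spos by blast
  qed
  \<comment> \<open>The factor 2 moves the values on \<open>K\<close> to the arguments where the step equals 1.\<close>
  define \<kappa> where "\<kappa> x = smooth_step (2 * (s x / \<delta>))" for x
  have sub: "{x. \<kappa> x \<noteq> 0} \<subseteq> (\<Union>y\<in>C. cball y (r y))"
  proof
    fix x assume "x \<in> {x. \<kappa> x \<noteq> 0}"
    then have "s x \<noteq> 0" by (intro notI) (simp add: \<kappa>_def smooth_step_0)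
    then obtain y where y: "y \<in> C" "pos_square ((r y)\<^sup>2 - (norm (x - y))\<^sup>2) \<noteq> 0"
      unfolding s_def using sum.not_neutral_contains_not_neutral by blast
    then have "(norm (x - y))\<^sup>2 < (r y)\<^sup>2" by (auto simp: pos_square_def max_def split: if_splits)
    moreover have "r y > 0" using y C r by auto
    ultimately have "norm (x - y) < r y" using power2_less_imp_less[of "norm (x - y)" "r y"] by simp
    then have "x \<in> cball y (r y)" by (simp add: dist_norm norm_minus_commute)
    then show "x \<in> (\<Union>y\<in>C. cball y (r y))" using y(1) by blast
  qed
  have cpt: "compact (\<Union>y\<in>C. cball y (r y))" using C(2) by (intro compact_UN) auto
  then have sub': "closure {x. \<kappa> x \<noteq> 0} \<subseteq> (\<Union>y\<in>C. cball y (r y))"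
    using sub closure_minimal compact_imp_closed by blast
  show ?thesis
  proof (rule that[of \<kappa>])
    show "C1_on UNIV \<kappa>"
      using C1_on_smooth_step[OF C1_on_scaleR_const[OF sC1, of "2 / \<delta>"]] by (simp add: \<kappa>_def[abs_def])
    show "compact (closure {x. \<kappa> x \<noteq> 0})"
      using sub' cpt by (metis closed_closure compact_Int_closed inf.absorb_iff2)
    have "(\<Union>y\<in>C. cball y (r y)) \<subseteq> V" using C(1) r by blast
    then show "closure {x. \<kappa> x \<noteq> 0} \<subseteq> V" using sub' by (rule order_trans[rotated])
    show "\<kappa> x = 1" if "x \<in> K" for x
    proof -
      have "1 \<le> s x / \<delta>" using \<delta>(2)[OF that] \<delta>(1) by simp
      then show ?thesis unfolding \<kappa>_def by (intro smooth_step_1) simp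
    qed
  qed (simp_all add: \<kappa>_def smooth_step_bounds)
qed

lemma continuous_on_divergence: "C1_on S \<phi> \<Longrightarrow> continuous_on S (divergence \<phi>)"
  unfolding divergence_def[abs_def] by (intro continuous_intros C1_on_continuous_fd)

lemma divergence_cong_open:
  assumes "open S" "x \<in> S" "\<And>y. y \<in> S \<Longrightarrow> f y = g y"
  shows "divergence f x = divergence g x"
  unfolding divergence_def by (simp only: fd_cong_open[OF assms])

lemma divergence_scaleR:
  assumes g: "C1_on S g" and f: "C1_on S f" and x: "x \<in> S"
  shows "divergence (\<lambda>x. g x *\<^sub>R f x) x = g x * divergence f x + fd g x (f x)"
proof -
  have "fd (\<lambda>x. g x *\<^sub>R f x) x = (\<lambda>v. g x *\<^sub>R fd f x v + fd g x v *\<^sub>R f x)"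
    by (intro fd_eqI has_derivative_scaleR C1_on_has_derivative[OF g x] C1_on_has_derivative[OF f x])
  then show ?thesis unfolding divergence_def fd_eq_sum_Basis[OF g x, of "f x"]
    by (simp add: inner_add_left sum.distrib sum_distrib_left mult.commute)
qed

lemma divergence_scaleR_const:
  assumes f: "C1_on S f" and x: "x \<in> S"
  shows "divergence (\<lambda>x. k *\<^sub>R f x) x = k * divergence f x"
proof -
  have "fd (\<lambda>x. k) x = (\<lambda>_. 0)" by (intro fd_eqI has_derivative_const)
  then show ?thesis using divergence_scaleR[OF C1_on_const f x, of k] by simp
qed

lemma divergence_add:
  assumes g: "C1_on S g" and f: "C1_on S f" and x: "x \<in> S"
  shows "divergence (\<lambda>x. g x + f x) x = divergence g x + divergence f x"
proof -
  have "fd (\<lambda>x. g x + f x) x = (\<lambda>v. fd g x v + fd f x v)"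
    by (intro fd_eqI has_derivative_add C1_on_has_derivative[OF g x] C1_on_has_derivative[OF f x])
  then show ?thesis by (simp add: divergence_def inner_add_left sum.distrib)
qed

section \<open>Integration of compactly supported derivatives\<close>

definition C1_compact :: "('a::euclidean_space \<Rightarrow> 'b::real_normed_vector) \<Rightarrow> bool" where
  "C1_compact f \<longleftrightarrow> C1_on UNIV f \<and> compact (closure {x. f x \<noteq> 0})"

lemma compact_if_closed_subset: "closed S \<Longrightarrow> S \<subseteq> K \<Longrightarrow> compact K \<Longrightarrow> compact (S::'a::t2_space set)"
  using compact_Int_closed by (metis inf.absorb_iff2)

lemma fd_outside_support:
  assumes "x \<notin> closure {x. f x \<noteq> 0}"
  shows "fd f x = (\<lambda>_. 0)"
proof -
  have "fd f x = fd (\<lambda>_. 0) x"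
    by (rule fd_cong_open[of "- closure {x. f x \<noteq> 0}"]) (use assms closure_subset[of "{x. f x \<noteq> 0}"] in auto)
  then show ?thesis by (simp add: fd_eqI[OF has_derivative_const])
qed

lemma divergence_outside_support:
  "x \<notin> closure {x. f x \<noteq> 0} \<Longrightarrow> divergence f x = 0"
  by (simp add: divergence_def fd_outside_support)

lemma integrable_continuous_compact_support:
  fixes f :: "'a::euclidean_space \<Rightarrow> 'b::{banach, second_countable_topology}"
  assumes "continuous_on UNIV f" "compact K" "\<And>x. x \<notin> K \<Longrightarrow> f x = 0"
  shows "integrable lebesgue f"
proof -
  have "integrable lborel (\<lambda>x. indicator K x *\<^sub>R f x)"
    by (rule borel_integrable_compact[OF assms(2) continuous_on_subset[OF assms(1) subset_UNIV]])
  moreover have "(\<lambda>x. indicator K x *\<^sub>R f x) = f"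
    using assms(3) by (auto simp: indicator_def)
  ultimately have "integrable lborel f" by simp
  then show ?thesis using integrable_completion[of f lborel] borel_measurable_integrable by blast
qed

lemma set_integrable_continuous_compact_support:
  fixes f :: "'a::euclidean_space \<Rightarrow> 'b::{banach, second_countable_topology}"
  assumes "continuous_on UNIV f" "compact K" "\<And>x. x \<notin> K \<Longrightarrow> f x = 0" "E \<in> sets lebesgue"
  shows "set_integrable lebesgue E f"
  unfolding set_integrable_def
  by (rule integrable_mult_indicator[OF assms(4) integrable_continuous_compact_support[OF assms(1-3)]])

lemma set_integrable_divergence:
  assumes "C1_compact \<phi>" "E \<in> sets lebesgue"
  shows "set_integrable lebesgue E (divergence \<phi>)"
proof (rule set_integrable_continuous_compact_support[OF _ _ divergence_outside_support assms(2)])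
  show "continuous_on UNIV (divergence \<phi>)" "compact (closure {x. \<phi> x \<noteq> 0})"
    using assms(1) continuous_on_divergence unfolding C1_compact_def by blast+
qed

text \<open>Stated for the completed measure, with which the perimeter is defined; continuity gives the Borel
measurability needed to pass to \<open>lborel\<close>.\<close>
lemma integral_translate:
  fixes f :: "'a::euclidean_space \<Rightarrow> real"
  assumes "continuous_on UNIV f"
  shows "(LINT x|lebesgue. f (x + a)) = (LINT x|lebesgue. f x)"
proof -
  have m: "f \<in> borel_measurable borel" using assms borel_measurable_continuous_onI by blast
  have m2: "(\<lambda>x. f (x + a)) \<in> borel_measurable borel" using m by measurable
  have "(LINT x|lebesgue. f x) = (LINT x|distr lborel borel ((+) a). f x)"
    using integral_completion[of f lborel] m by (simp add: lborel_distr_plus)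
  also have "\<dots> = (LINT x|lborel. f (a + x))"
    by (rule integral_distr) (use m in auto)
  also have "\<dots> = (LINT x|lebesgue. f (x + a))"
    using integral_completion[of "\<lambda>x. f (x + a)" lborel] m2 by (simp add: add.commute)
  finally show ?thesis by simp
qed

lemma has_derivative_along_line:
  fixes f :: "'a::euclidean_space \<Rightarrow> real"
  assumes "(f has_derivative f') (at (x + t *\<^sub>R h))"
  shows "((\<lambda>s. f (x + s *\<^sub>R h)) has_real_derivative f' h) (at t)"
proof -
  have "((\<lambda>s. x + s *\<^sub>R h) has_derivative (\<lambda>s. s *\<^sub>R h)) (at t)"
    by (auto intro!: derivative_eq_intros)
  from has_derivative_compose[OF this assms]
  have "((\<lambda>s. f (x + s *\<^sub>R h)) has_derivative (\<lambda>s. f' (s *\<^sub>R h))) (at t)" .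
  moreover have "(\<lambda>s. f' (s *\<^sub>R h)) = (*) (f' h)"
    using linear_cmul[OF has_derivative_linear[OF assms]] by (auto simp: mult.commute)
  ultimately show ?thesis unfolding has_field_derivative_def by simp
qed

text \<open>Differentiation under the integral by dominated convergence: the difference quotients are bounded by
the maximum of the directional derivative and vanish outside one ball that contains all the
translated supports. The case \<open>E = UNIV\<close> yields integration by parts, general \<open>E\<close> the
translation argument for weakly constant indicators.\<close>
lemma set_integral_translate_has_derivative:
  fixes f :: "'a::euclidean_space \<Rightarrow> real"
  assumes f: "C1_compact f" and E: "E \<in> sets lebesgue"
  shows "((\<lambda>t. LINT x:E|lebesgue. f (x + t *\<^sub>R h)) has_real_derivative
           (LINT x:E|lebesgue. fd f (x + t *\<^sub>R h) h)) (at t)"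
proof -
  define S where "S = closure {x. f x \<noteq> 0}"
  have fC1: "C1_on UNIV f" and S: "compact S" using f by (auto simp: C1_compact_def S_def)
  have f0: "f x = 0" "fd f x h = 0" if "x \<notin> S" for x
    using that fd_outside_support[of x f] closure_subset[of "{x. f x \<noteq> 0}"] unfolding S_def by auto
  have cf: "continuous_on UNIV f" by (rule C1_on_continuous[OF fC1])
  have cd: "continuous_on UNIV (\<lambda>x. fd f x h)" by (rule C1_on_continuous_fd[OF fC1])
  have ctr: "continuous_on UNIV (\<lambda>x. g (x + s *\<^sub>R h))" if "continuous_on UNIV g" for s and g :: "'a \<Rightarrow> real"
    by (rule continuous_on_compose2[OF that]) (auto intro: continuous_intros)
  obtain R where R: "\<And>x. x \<in> S \<Longrightarrow> norm x \<le> R" 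
    using compact_imp_bounded[OF S] unfolding bounded_iff by blast
  have "compact ((\<lambda>x. fd f x h) ` S)"
    by (rule compact_continuous_image[OF continuous_on_subset[OF cd subset_UNIV] S])
  then obtain M0 where M0: "\<And>x. x \<in> S \<Longrightarrow> norm (fd f x h) \<le> M0"

    using compact_imp_bounded[of "(\<lambda>x. fd f x h) ` S"] unfolding bounded_iff by blast
  define M where "M = max M0 0"
  have M: "norm (fd f x h) \<le> M" for x
    using M0[of x] f0(2)[of x] by (cases "x \<in> S") (auto simp: M_def)
  have line: "((\<lambda>s. f (x + s *\<^sub>R h)) has_real_derivative fd f (x + s *\<^sub>R h) h) (at s)" for x s
    by (rule has_derivative_along_line[OF C1_on_has_derivative[OF fC1 UNIV_I]])
  have lip: "norm (f (x + s *\<^sub>R h) - f (x + t *\<^sub>R h)) \<le> M * norm (s - t)" for x s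
    by (rule field_differentiable_bound[of UNIV "\<lambda>s. f (x + s *\<^sub>R h)" "\<lambda>s. fd f (x + s *\<^sub>R h) h"])
      (simp_all only: convex_UNIV UNIV_I line M)
  have K: "f (x + s *\<^sub>R h) = 0" if "norm x > R + T * norm h" "\<bar>s\<bar> \<le> T" for x s T
  proof -
    have "norm x \<le> norm (x + s *\<^sub>R h) + norm (s *\<^sub>R h)" using norm_triangle_ineq4[of "x + s *\<^sub>R h" "s *\<^sub>R h"] by simp
    moreover have "norm (s *\<^sub>R h) \<le> T * norm h" using that(2) by (simp add: mult_right_mono)
    ultimately have "norm (x + s *\<^sub>R h) > R" using that(1) by linarith
    then show ?thesis using R f0(1) by force
  qed
  have intg: "set_integrable lebesgue E (\<lambda>x. f (x + s *\<^sub>R h))" for s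
    by (rule set_integrable_continuous_compact_support[OF ctr[OF cf] compact_cball[of 0 "R + \<bar>s\<bar> * norm h"] _ E])
      (rule K[of "\<bar>s\<bar>"], simp_all)
  define F where "F t = (LINT x:E|lebesgue. f (x + t *\<^sub>R h))" for t
  have "((\<lambda>s. (F s - F t) / (s - t)) \<longlongrightarrow> (LINT x:E|lebesgue. fd f (x + t *\<^sub>R h) h)) (at t)"
    unfolding tendsto_at_iff_sequentially
  proof (intro allI impI)
    fix X :: "nat \<Rightarrow> real" assume X: "\<forall>i. X i \<in> UNIV - {t}" and Xt: "X \<longlonglongrightarrow> t"
    obtain T0 where T0: "\<And>i. \<bar>X i\<bar> \<le> T0"
      using Xt convergent_imp_Bseq[of X] unfolding Bseq_def convergent_def by fastforce
    define T where "T = max T0 \<bar>t\<bar>"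
    have T: "\<bar>X i\<bar> \<le> T" "\<bar>t\<bar> \<le> T" for i using T0[of i] by (auto simp: T_def)
    define q where "q i x = (f (x + X i *\<^sub>R h) - f (x + t *\<^sub>R h)) / (X i - t)" for i x
    define w where "w x = M * indicator (cball (0::'a) (R + T * norm h)) x" for x
    have quot: "(F (X i) - F t) / (X i - t) = (LINT x:E|lebesgue. q i x)" for i
      unfolding F_def q_def by (simp only: set_integral_divide_zero set_integral_diff(2)[OF intg intg])
    have "(\<lambda>i. LINT x|lebesgue. indicator E x *\<^sub>R q i x) \<longlonglongrightarrow> (LINT x|lebesgue. indicator E x *\<^sub>R fd f (x + t *\<^sub>R h) h)"
    proof (rule integral_dominated_convergence[where w=w])
      have mE: "(\<lambda>x. indicator E x *\<^sub>R g x) \<in> borel_measurable lebesgue" if "continuous_on UNIV g" for g :: "'a \<Rightarrow> real"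
      proof -
        have "g \<in> borel_measurable lebesgue"
          using borel_measurable_continuous_onI[OF that] by (simp add: measurable_completion)
        then show ?thesis using E by (intro borel_measurable_scaleR borel_measurable_indicator) auto
      qed
      show "(\<lambda>x. indicator E x *\<^sub>R fd f (x + t *\<^sub>R h) h) \<in> borel_measurable lebesgue"
        by (rule mE[OF ctr[OF cd]])
      show "(\<lambda>x. indicator E x *\<^sub>R q i x) \<in> borel_measurable lebesgue" for i
        by (rule mE) (unfold q_def divide_inverse, intro continuous_on_mult continuous_on_diff continuous_on_const ctr[OF cf])
      show "integrable lebesgue w" unfolding w_def
        by (intro integrable_mult_right integrable_real_indicator) (use emeasure_compact_finite[OF compact_cball] in auto)
      show "AE x in lebesgue. (\<lambda>i. indicator E x *\<^sub>R q i x) \<longlonglongrightarrow> indicator E x *\<^sub>R fd f (x + t *\<^sub>R h) h"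
      proof (rule AE_I2)
        fix x
        have "((\<lambda>s. (f (x + s *\<^sub>R h) - f (x + t *\<^sub>R h)) / (s - t)) \<longlongrightarrow> fd f (x + t *\<^sub>R h) h) (at t)"
          using line[of x t] unfolding has_field_derivative_iff by simp
        then have "(\<lambda>i. q i x) \<longlonglongrightarrow> fd f (x + t *\<^sub>R h) h"
          using X Xt unfolding tendsto_at_iff_sequentially q_def comp_def by blast
        then show "(\<lambda>i. indicator E x *\<^sub>R q i x) \<longlonglongrightarrow> indicator E x *\<^sub>R fd f (x + t *\<^sub>R h) h"
          by (intro tendsto_intros)
      qed
      show "AE x in lebesgue. norm (indicator E x *\<^sub>R q i x) \<le> w x" for i
      proof (rule AE_I2)
        fix x
        have Xi: "X i \<noteq> t" using X by auto
        have "norm (q i x) \<le> w x"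
        proof (cases "norm x > R + T * norm h")
          case True
          then show ?thesis using K[OF True T(1)] K[OF True T(2)] by (simp add: q_def w_def)
        next
          case False
          then show ?thesis using lip[of x "X i"] Xi by (simp add: q_def w_def divide_simps)
        qed
        moreover have "norm (indicator E x *\<^sub>R q i x) \<le> norm (q i x)" by (simp add: indicator_def)
        ultimately show "norm (indicator E x *\<^sub>R q i x) \<le> w x" by linarith
      qed
    qed
    then show "((\<lambda>s. (F s - F t) / (s - t)) \<circ> X) \<longlonglongrightarrow> (LINT x:E|lebesgue. fd f (x + t *\<^sub>R h) h)"
      by (simp add: comp_def quot set_lebesgue_integral_def)
  qed
  then show ?thesis unfolding has_field_derivative_iff F_def .
qed

lemma set_integral_UNIV: "(LINT x:UNIV|M. f x) = (LINT x|M. f x)"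
  by (simp add: set_lebesgue_integral_def)

text \<open>The integral of a translate does not depend on the translation, and the derivative of this constant
is the integral of the derivative.\<close>
lemma integral_fd_eq_0:
  fixes f :: "'a::euclidean_space \<Rightarrow> real"
  assumes f: "C1_compact f"
  shows "(LINT x|lebesgue. fd f x h) = 0"
proof -
  have c: "continuous_on UNIV f" using f C1_on_continuous unfolding C1_compact_def by blast
  have "((\<lambda>t. LINT x|lebesgue. f (x + t *\<^sub>R h)) has_real_derivative (LINT x|lebesgue. fd f x h)) (at 0)"
    using set_integral_translate_has_derivative[OF f, of UNIV h 0] by (simp add: set_integral_UNIV)
  then have "((\<lambda>t::real. LINT x|lebesgue. f x) has_real_derivative (LINT x|lebesgue. fd f x h)) (at 0)"
    by (simp only: integral_translate[OF c])
  then show ?thesis using DERIV_const DERIV_unique by blast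
qed

lemma integral_divergence_eq_0:
  assumes \<phi>: "C1_compact \<phi>"
  shows "(LINT x|lebesgue. divergence \<phi> x) = 0"
proof -
  have C1: "C1_on UNIV \<phi>" and K: "compact (closure {x. \<phi> x \<noteq> 0})" using \<phi> by (auto simp: C1_compact_def)
  have d: "((\<lambda>x. \<phi> x \<bullet> b) has_derivative (\<lambda>v. fd \<phi> x v \<bullet> b)) (at x)" for x b
    by (intro has_derivative_inner_left C1_on_has_derivative[OF C1 UNIV_I])
  have "C1_compact (\<lambda>x. \<phi> x \<bullet> b)" for b
    unfolding C1_compact_def
  proof
    show "C1_on UNIV (\<lambda>x. \<phi> x \<bullet> b)"
      by (rule C1_onI[OF d]) (intro continuous_on_inner C1_on_continuous_fd[OF C1] continuous_on_const)
    have "closure {x. \<phi> x \<bullet> b \<noteq> 0} \<subseteq> closure {x. \<phi> x \<noteq> 0}" by (intro closure_mono) auto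
    then show "compact (closure {x. \<phi> x \<bullet> b \<noteq> 0})"
      using compact_if_closed_subset[OF closed_closure _ K] by blast
  qed
  then have 0: "(LINT x|lebesgue. fd (\<lambda>x. \<phi> x \<bullet> b) x b) = 0" for b by (rule integral_fd_eq_0)
  have "(LINT x|lebesgue. divergence \<phi> x) = (LINT x|lebesgue. (\<Sum>b\<in>Basis. fd (\<lambda>x. \<phi> x \<bullet> b) x b))"
    by (simp add: divergence_def fd_eqI[OF d])
  also have "\<dots> = (\<Sum>b\<in>Basis. LINT x|lebesgue. fd (\<lambda>x. \<phi> x \<bullet> b) x b)"
  proof (rule Bochner_Integration.integral_sum)
    show "integrable lebesgue (\<lambda>x. fd (\<lambda>x. \<phi> x \<bullet> b) x b)" for b
    proof (rule integrable_continuous_compact_support[OF _ K])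
      show "continuous_on UNIV (\<lambda>x. fd (\<lambda>x. \<phi> x \<bullet> b) x b)"
        unfolding fd_eqI[OF d] by (intro continuous_on_inner C1_on_continuous_fd[OF C1] continuous_on_const)
      show "fd (\<lambda>x. \<phi> x \<bullet> b) x b = 0" if "x \<notin> closure {x. \<phi> x \<noteq> 0}" for x
        unfolding fd_eqI[OF d] fd_outside_support[OF that] by simp
    qed
  qed
  finally show ?thesis by (simp add: 0)
qed

section \<open>The maximum principle for the length of the gradient\<close>

definition grad :: "('a::euclidean_space \<Rightarrow> real) \<Rightarrow> 'a \<Rightarrow> 'a" where
  "grad f x = (\<Sum>b\<in>Basis. fd f x b *\<^sub>R b)"

lemma grad_inner:
  assumes "C1_on S f" "x \<in> S"
  shows "grad f x \<bullet> y = fd f x y"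
  unfolding grad_def fd_eq_sum_Basis[OF assms, of y]
  by (simp add: inner_sum_left mult.commute inner_commute[of y])

lemma norm_grad_square: "(norm (grad f x))\<^sup>2 = (\<Sum>b\<in>Basis. fd f x b * fd f x b)"
proof -
  have "grad f x \<bullet> b = fd f x b" if "b \<in> Basis" for b
    unfolding grad_def using that by (simp add: inner_sum_left_Basis)
  then show ?thesis by (simp add: power2_norm_eq_inner euclidean_inner[of "grad f x" "grad f x"])
qed

lemma smooth_on_imp_C1_on: "smooth_on S f \<Longrightarrow> C1_on S f"
  unfolding smooth_on_def C1_on_def by blast

lemma Ck_on_subset: "Ck_on k S g \<Longrightarrow> T \<subseteq> S \<Longrightarrow> Ck_on k T g"
proof (induction k arbitrary: g)
  case 0
  then show ?case unfolding Ck_on.simps by (rule continuous_on_subset)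
next
  case (Suc k)
  then show ?case unfolding Ck_on.simps by blast
qed

lemma smooth_on_subset: "smooth_on S f \<Longrightarrow> T \<subseteq> S \<Longrightarrow> smooth_on T f"
  unfolding smooth_on_def using Ck_on_subset by blast

lemma smooth_on_fd: 
  assumes "smooth_on S f" shows "smooth_on S (\<lambda>x. fd f x v)"
proof -
  have "Ck_on (Suc k) S f" for k using assms unfolding smooth_on_def by blast
  then show ?thesis unfolding smooth_on_def Ck_on.simps by blast
qed

lemma C1_on_grad:
  assumes "smooth_on S f"
  shows "C1_on S (grad f)"
  unfolding grad_def[abs_def]
  by (intro C1_on_sum C1_on_scaleR C1_on_const smooth_on_imp_C1_on smooth_on_fd assms)

lemma divergence_grad:
  assumes "smooth_on S f" "x \<in> S"
  shows "divergence (grad f) x = laplacian f x"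
proof -
  have "(grad f has_derivative (\<lambda>v. \<Sum>b\<in>Basis. fd (\<lambda>y. fd f y b) x v *\<^sub>R b)) (at x)"
    unfolding grad_def[abs_def]
    by (intro has_derivative_sum has_derivative_scaleR_left
        C1_on_has_derivative[OF smooth_on_imp_C1_on[OF smooth_on_fd[OF assms(1)]] assms(2)])
  then show ?thesis unfolding divergence_def laplacian_def
    by (simp only: fd_eqI) (simp add: inner_sum_left_Basis)
qed

text \<open>The mean value theorem is applied twice to the mixed second difference, first in direction \<open>a\<close>, then
in direction \<open>b\<close>. The left-hand side is symmetric in \<open>a\<close> and \<open>b\<close>, the right-hand side is not.\<close>
lemma second_difference_mvt:
  fixes f :: "'a::euclidean_space \<Rightarrow> real"
  assumes f: "C1_on S f" and fa: "C1_on S (\<lambda>y. fd f y a)"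
    and h: "h > 0" and S: "\<And>s t. 0 \<le> s \<Longrightarrow> s \<le> h \<Longrightarrow> 0 \<le> t \<Longrightarrow> t \<le> h \<Longrightarrow> x + s *\<^sub>R a + t *\<^sub>R b \<in> S"
  obtains s t where "0 < s" "s < h" "0 < t" "t < h"
    "f (x + h *\<^sub>R a + h *\<^sub>R b) - f (x + h *\<^sub>R a) - f (x + h *\<^sub>R b) + f x
      = h * h * fd (\<lambda>y. fd f y a) (x + s *\<^sub>R a + t *\<^sub>R b) b"
proof -
  have S0: "x + s *\<^sub>R a \<in> S" if "0 \<le> s" "s \<le> h" for s using S[OF that, of 0] h by simp
  have d1: "((\<lambda>s. f ((x + h *\<^sub>R b) + s *\<^sub>R a) - f (x + s *\<^sub>R a)) has_real_derivative
      fd f ((x + h *\<^sub>R b) + s *\<^sub>R a) a - fd f (x + s *\<^sub>R a) a) (at s)" if "0 \<le> s" "s \<le> h" for s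
  proof (rule DERIV_diff)
    have "(x + h *\<^sub>R b) + s *\<^sub>R a \<in> S" using S[OF that, of h] h by (simp add: add_ac)
    then show "((\<lambda>s. f ((x + h *\<^sub>R b) + s *\<^sub>R a)) has_real_derivative fd f ((x + h *\<^sub>R b) + s *\<^sub>R a) a) (at s)"
      by (rule has_derivative_along_line[OF C1_on_has_derivative[OF f]])
    show "((\<lambda>s. f (x + s *\<^sub>R a)) has_real_derivative fd f (x + s *\<^sub>R a) a) (at s)"
      by (rule has_derivative_along_line[OF C1_on_has_derivative[OF f S0[OF that]]])
  qed
  obtain s where s: "0 < s" "s < h" and e1:
    "(f ((x + h *\<^sub>R b) + h *\<^sub>R a) - f (x + h *\<^sub>R a)) - (f ((x + h *\<^sub>R b) + 0 *\<^sub>R a) - f (x + 0 *\<^sub>R a))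
     = (h - 0) * (fd f ((x + h *\<^sub>R b) + s *\<^sub>R a) a - fd f (x + s *\<^sub>R a) a)"
    using MVT2[OF h d1] by blast
  have d2: "((\<lambda>t. fd f ((x + s *\<^sub>R a) + t *\<^sub>R b) a) has_real_derivative
      fd (\<lambda>y. fd f y a) ((x + s *\<^sub>R a) + t *\<^sub>R b) b) (at t)" if "0 \<le> t" "t \<le> h" for t
    by (rule has_derivative_along_line[OF C1_on_has_derivative[OF fa]]) (use S[of s t] s that in auto)
  obtain t where t: "0 < t" "t < h" and e2:
    "fd f ((x + s *\<^sub>R a) + h *\<^sub>R b) a - fd f ((x + s *\<^sub>R a) + 0 *\<^sub>R b) a
     = (h - 0) * fd (\<lambda>y. fd f y a) ((x + s *\<^sub>R a) + t *\<^sub>R b) b"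
    using MVT2[OF h d2] by blast
  show ?thesis
  proof (rule that[OF s t])
    have "f (x + h *\<^sub>R a + h *\<^sub>R b) - f (x + h *\<^sub>R a) - f (x + h *\<^sub>R b) + f x
      = h * (fd f ((x + s *\<^sub>R a) + h *\<^sub>R b) a - fd f (x + s *\<^sub>R a) a)"
      using e1 by (simp add: add_ac)
    then show "f (x + h *\<^sub>R a + h *\<^sub>R b) - f (x + h *\<^sub>R a) - f (x + h *\<^sub>R b) + f x
      = h * h * fd (\<lambda>y. fd f y a) (x + s *\<^sub>R a + t *\<^sub>R b) b"
      using e2 by simp
  qed
qed

text \<open>Both mixed derivatives occur as values of the same second difference at points arbitrarily close to
\<open>x\<close>; by continuity they agree at \<open>x\<close>.\<close>
lemma second_derivative_symmetric:
  fixes f :: "'a::euclidean_space \<Rightarrow> real"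
  assumes S: "open S" "x \<in> S" and f: "C1_on S f" "\<And>v. C1_on S (\<lambda>y. fd f y v)"
  shows "fd (\<lambda>y. fd f y a) x b = fd (\<lambda>y. fd f y b) x a"
proof (rule ccontr)
  define A where "A y = fd (\<lambda>y. fd f y a) y b" for y
  define B where "B y = fd (\<lambda>y. fd f y b) y a" for y
  assume "\<not> ?thesis"
  then have ne: "A x \<noteq> B x" by (simp add: A_def B_def)
  define e where "e = \<bar>A x - B x\<bar> / 2"
  have e: "e > 0" using ne by (simp add: e_def)
  have "isCont A x" "isCont B x"
    unfolding A_def[abs_def] B_def[abs_def]
    using C1_on_continuous_fd[OF f(2)] continuous_on_eq_continuous_at[OF S(1)] S(2) by blast+
  then obtain d1 d2 where d1: "d1 > 0" "\<And>y. dist y x < d1 \<Longrightarrow> dist (A y) (A x) < e"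
    and d2: "d2 > 0" "\<And>y. dist y x < d2 \<Longrightarrow> dist (B y) (B x) < e"
    unfolding continuous_at_eps_delta using e by (metis dist_commute)
  obtain d3 where d3: "d3 > 0" "ball x d3 \<subseteq> S" using S open_contains_ball by blast
  define d where "d = min d1 (min d2 d3)"
  have d: "d > 0" using d1 d2 d3 by (simp add: d_def)
  \<comment> \<open>The whole parallelogram spanned by \<open>h *\<^sub>R a\<close> and \<open>h *\<^sub>R b\<close> lies within distance \<open>d\<close> of \<open>x\<close>.\<close>
  define h where "h = d / (2 * (norm a + norm b + 1))"
  have nn: "norm a + norm b + 1 > 0" by (simp add: add_nonneg_pos)
  have h: "h > 0" using d nn by (simp add: h_def)
  have hd: "h * (norm a + norm b) < d"
  proof -
    have "h * (norm a + norm b) < h * (2 * (norm a + norm b + 1))"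
      using h by (intro mult_strict_left_mono) (auto simp: add_nonneg_pos intro: add_nonneg_nonneg less_le_trans)
    also have "\<dots> = d" using nn by (simp add: h_def)
    finally show ?thesis .
  qed
  have near: "dist (x + s *\<^sub>R p + t *\<^sub>R q) x < d"
    if "0 \<le> s" "s \<le> h" "0 \<le> t" "t \<le> h" "norm p + norm q = norm a + norm b" for s t p q
  proof -
    have "dist (x + s *\<^sub>R p + t *\<^sub>R q) x = norm (s *\<^sub>R p + t *\<^sub>R q)" by (simp add: dist_norm algebra_simps)
    also have "\<dots> \<le> s * norm p + t * norm q" using that(1,3) by (metis norm_triangle_ineq norm_scaleR abs_of_nonneg)
    also have "\<dots> \<le> h * norm p + h * norm q" using that by (intro add_mono mult_right_mono) auto
    also have "\<dots> = h * (norm a + norm b)" using that(5) by (metis distrib_left)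
    finally show ?thesis using hd by linarith
  qed
  have inS: "y \<in> S" if "dist y x < d" for y using that d3 by (auto simp: d_def dist_commute)
  obtain s t where st: "0 < s" "s < h" "0 < t" "t < h"
    "f (x + h *\<^sub>R a + h *\<^sub>R b) - f (x + h *\<^sub>R a) - f (x + h *\<^sub>R b) + f x
      = h * h * fd (\<lambda>y. fd f y a) (x + s *\<^sub>R a + t *\<^sub>R b) b"
    by (rule second_difference_mvt[OF f(1) f(2) h inS[OF near], of a b]) auto
  obtain s' t' where st': "0 < s'" "s' < h" "0 < t'" "t' < h"
    "f (x + h *\<^sub>R b + h *\<^sub>R a) - f (x + h *\<^sub>R b) - f (x + h *\<^sub>R a) + f x
      = h * h * fd (\<lambda>y. fd f y b) (x + s' *\<^sub>R b + t' *\<^sub>R a) a"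
    by (rule second_difference_mvt[OF f(1) f(2) h inS[OF near], of b a]) auto
  have sw: "x + h *\<^sub>R b + h *\<^sub>R a = x + h *\<^sub>R a + h *\<^sub>R b" by (simp add: add_ac)
  then have "h * h * A (x + s *\<^sub>R a + t *\<^sub>R b) = h * h * B (x + s' *\<^sub>R b + t' *\<^sub>R a)"
    using st(5) st'(5)[unfolded sw] unfolding A_def B_def by linarith
  then have eq: "A (x + s *\<^sub>R a + t *\<^sub>R b) = B (x + s' *\<^sub>R b + t' *\<^sub>R a)" using h by simp
  have "dist (A (x + s *\<^sub>R a + t *\<^sub>R b)) (A x) < e"
    by (rule d1(2)) (use near[of s t a b] st in \<open>simp add: d_def\<close>)
  moreover have "dist (B (x + s' *\<^sub>R b + t' *\<^sub>R a)) (B x) < e"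
    by (rule d2(2)) (use near[of s' t' b a] st' in \<open>simp add: d_def\<close>)
  ultimately have "dist (A x) (B x) < e + e"
    unfolding eq using dist_triangle3[of "A x" "B x" "B (x + s' *\<^sub>R b + t' *\<^sub>R a)"] by linarith
  then show False by (simp add: e_def dist_real_def)
qed

text \<open>If the second derivative were positive, the first derivative, which vanishes at the maximum, would be
positive just after it, and the function would increase.\<close>
lemma second_derivative_nonpos_at_max:
  fixes f :: "'a::euclidean_space \<Rightarrow> real"
  assumes S: "open S" "x \<in> S" and f: "C1_on S f" "C1_on S (\<lambda>y. fd f y v)"
    and max: "\<And>y. y \<in> S \<Longrightarrow> f y \<le> f x"
  shows "fd (\<lambda>y. fd f y v) x v \<le> 0"
proof (rule ccontr)
  assume "\<not> ?thesis"
  then have pos: "fd (\<lambda>y. fd f y v) x v > 0" by simp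
  have "open ((\<lambda>t. x + t *\<^sub>R v) -` S)" by (intro open_vimage S(1) continuous_intros)
  then obtain \<delta> where \<delta>: "\<delta> > 0" "ball 0 \<delta> \<subseteq> (\<lambda>t. x + t *\<^sub>R v) -` S"
    using S(2) unfolding open_contains_ball by force
  have inS: "x + t *\<^sub>R v \<in> S" if "\<bar>t\<bar> < \<delta>" for t using \<delta>(2) that by (auto simp: dist_real_def)
  have d1: "((\<lambda>t. f (x + t *\<^sub>R v)) has_real_derivative fd f (x + t *\<^sub>R v) v) (at t)" if "\<bar>t\<bar> < \<delta>" for t
    by (rule has_derivative_along_line[OF C1_on_has_derivative[OF f(1) inS[OF that]]])
  have d2: "((\<lambda>t. fd f (x + t *\<^sub>R v) v) has_real_derivative fd (\<lambda>y. fd f y v) x v) (at 0)"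
    by (rule has_derivative_along_line) (use C1_on_has_derivative[OF f(2) S(2)] in simp)
  have "fd f (x + 0 *\<^sub>R v) v = 0"
    by (rule DERIV_local_max[OF d1[of 0] \<delta>(1)]) (use \<delta>(1) max inS in auto)
  then have 0: "fd f x v = 0" by simp
  obtain d where d: "d > 0" "\<And>h. 0 < h \<Longrightarrow> h < d \<Longrightarrow> fd f (x + 0 *\<^sub>R v) v < fd f (x + (0 + h) *\<^sub>R v) v"
    using DERIV_pos_inc_right[OF d2 pos] by blast
  define h where "h = min d \<delta> / 2"
  have h: "0 < h" "h < d" "h < \<delta>" using d(1) \<delta>(1) by (auto simp: h_def)
  obtain z where z: "0 < z" "z < h" "f (x + h *\<^sub>R v) - f (x + 0 *\<^sub>R v) = (h - 0) * fd f (x + z *\<^sub>R v) v"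
    using MVT2[OF h(1) d1] h by (metis abs_of_nonneg le_less_trans)
  have "fd f (x + z *\<^sub>R v) v > 0" using d(2)[of z] z h 0 by simp
  then have "f (x + h *\<^sub>R v) > f x" using z(3) h(1) by (simp add: algebra_simps)
  then show False using max[OF inS[of h]] h by simp
qed

text \<open>Third derivatives may be permuted: symmetry is used once for \<open>f\<close> and once for a partial derivative
of \<open>f\<close>.\<close>
lemma fd_laplacian_commute:
  assumes S: "open S" "x \<in> S" and f: "smooth_on S f"
  shows "(\<Sum>j\<in>Basis. fd (\<lambda>y. fd (\<lambda>z. fd f z i) y j) x j) = fd (laplacian f) x i"
proof -
  note sm = smooth_on_fd[OF f] 
  have "fd (\<lambda>y. fd (\<lambda>z. fd f z i) y j) x j = fd (\<lambda>y. fd (\<lambda>z. fd f z j) y j) x i" for j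
  proof -
    have "fd (\<lambda>y. fd (\<lambda>z. fd f z i) y j) x j = fd (\<lambda>y. fd (\<lambda>z. fd f z j) y i) x j"
      by (rule fun_cong[OF fd_cong_open[OF S]])
        (rule second_derivative_symmetric[OF S(1) _ smooth_on_imp_C1_on[OF f] smooth_on_imp_C1_on[OF sm]])
    also have "\<dots> = fd (\<lambda>y. fd (\<lambda>z. fd f z j) y j) x i"
      by (rule second_derivative_symmetric[OF S smooth_on_imp_C1_on[OF sm]
            smooth_on_imp_C1_on[OF smooth_on_fd[OF sm]]])
    finally show ?thesis .
  qed
  moreover have "(laplacian f has_derivative (\<lambda>v. \<Sum>j\<in>Basis. fd (\<lambda>y. fd (\<lambda>z. fd f z j) y j) x v)) (at x)"
    unfolding laplacian_def[abs_def]
    by (intro has_derivative_sum C1_on_has_derivative[OF smooth_on_imp_C1_on[OF smooth_on_fd[OF sm]] S(2)])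
  ultimately show ?thesis by (simp add: fd_eqI)
qed

text \<open>Bochner's formula \<open>\<Delta>|\<nabla>f|\<^sup>2 = 2|D\<^sup>2f|\<^sup>2 + 2\<nabla>f \<cdot> \<nabla>\<Delta>f\<close> in flat space.\<close>
lemma laplacian_norm_grad_square:
  fixes f :: "'a::euclidean_space \<Rightarrow> real"
  assumes S: "open S" "x \<in> S" and f: "smooth_on S f"
  defines "q \<equiv> \<lambda>x. (norm (grad f x))\<^sup>2"
  shows "laplacian q x = 2 * (\<Sum>j\<in>Basis. \<Sum>i\<in>Basis. (fd (\<lambda>y. fd f y i) x j)\<^sup>2)
            + 2 * (\<Sum>i\<in>Basis. fd f x i * fd (laplacian f) x i)"
    and "C1_on S q" and "C1_on S (\<lambda>y. fd q y v)"
proof -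
  define p where "p i y = fd f y i" for i y
  have p: "smooth_on S (p i)" for i unfolding p_def by (rule smooth_on_fd[OF f])
  have dp: "C1_on S (\<lambda>y. fd (p i) y w)" for i w by (intro smooth_on_imp_C1_on smooth_on_fd p)
  have pC1: "C1_on S (p i)" for i by (intro smooth_on_imp_C1_on p)
  have q: "q = (\<lambda>y. \<Sum>i\<in>Basis. p i y * p i y)" unfolding q_def norm_grad_square p_def ..
  show "C1_on S q" unfolding q by (intro C1_on_sum C1_on_mult pC1)
  have dq: "(q has_derivative (\<lambda>w. \<Sum>i\<in>Basis. 2 * (p i y * fd (p i) y w))) (at y)" if "y \<in> S" for y
  proof -
    have "(q has_derivative (\<lambda>w. \<Sum>i\<in>Basis. p i y * fd (p i) y w + fd (p i) y w * p i y)) (at y)"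
      unfolding q by (intro has_derivative_sum has_derivative_mult C1_on_has_derivative[OF pC1 that])
    then show ?thesis by (simp add: mult.commute)
  qed
  have fdq: "(\<Sum>i\<in>Basis. 2 * (p i y * fd (p i) y w)) = fd q y w" if "y \<in> S" for y w
    using fd_eqI[OF dq[OF that]] by simp
  have C1: "C1_on S (\<lambda>y. \<Sum>i\<in>Basis. 2 * (p i y * fd (p i) y w))" for w
    by (intro C1_on_sum C1_on_mult C1_on_const pC1 dp)
  show "C1_on S (\<lambda>y. fd q y v)" by (rule C1_on_cong[OF S(1) C1 fdq])
  have "fd (\<lambda>y. fd q y j) x j = (\<Sum>i\<in>Basis. 2 * (p i x * fd (\<lambda>y. fd (p i) y j) x j + fd (p i) x j * fd (p i) x j))" for j
  proof -
    have "fd (\<lambda>y. fd q y j) x = fd (\<lambda>y. \<Sum>i\<in>Basis. 2 * (p i y * fd (p i) y j)) x"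
      by (rule fd_cong_open[OF S fdq[symmetric]])
    also have "\<dots> = (\<lambda>w. \<Sum>i\<in>Basis. 2 * (p i x * fd (\<lambda>y. fd (p i) y j) x w + fd (p i) x w * fd (p i) x j))"
      by (intro fd_eqI has_derivative_sum has_derivative_mult_right has_derivative_mult
          C1_on_has_derivative[OF pC1 S(2)] C1_on_has_derivative[OF dp S(2)])
    finally show ?thesis by simp
  qed
  then have "laplacian q x = (\<Sum>j\<in>Basis. \<Sum>i\<in>Basis. 2 * (fd (p i) x j)\<^sup>2 + 2 * (p i x * fd (\<lambda>y. fd (p i) y j) x j))"
    by (simp add: laplacian_def power2_eq_square algebra_simps)
  also have "\<dots> = 2 * (\<Sum>j\<in>Basis. \<Sum>i\<in>Basis. (fd (p i) x j)\<^sup>2)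
      + 2 * (\<Sum>j\<in>Basis. \<Sum>i\<in>Basis. p i x * fd (\<lambda>y. fd (p i) y j) x j)"
    by (simp add: sum.distrib sum_distrib_left)
  also have "(\<Sum>j\<in>Basis. \<Sum>i\<in>Basis. p i x * fd (\<lambda>y. fd (p i) y j) x j)
      = (\<Sum>i\<in>Basis. p i x * (\<Sum>j\<in>Basis. fd (\<lambda>y. fd (p i) y j) x j))"
    by (subst sum.swap) (simp add: sum_distrib_left)
  also have "\<dots> = (\<Sum>i\<in>Basis. p i x * fd (laplacian f) x i)"
    unfolding p_def fd_laplacian_commute[OF S f] ..
  finally show "laplacian q x = 2 * (\<Sum>j\<in>Basis. \<Sum>i\<in>Basis. (fd (\<lambda>y. fd f y i) x j)\<^sup>2)
            + 2 * (\<Sum>i\<in>Basis. fd f x i * fd (laplacian f) x i)" by (simp add: p_def)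
qed

text \<open>For constant nonzero Laplacian, Bochner's formula makes \<open>|\<nabla>f|\<^sup>2\<close> strictly subharmonic: the Hessian
cannot vanish, because its trace does not. So there is no interior maximum, and the inequality
is strict.\<close>
lemma norm_grad_less_boundary_value:
  fixes f :: "'a::euclidean_space \<Rightarrow> real"
  assumes \<Omega>: "open \<Omega>" "bounded \<Omega>" "closure \<Omega> \<subseteq> U" and f: "smooth_on U f"
    and pde: "\<And>x. x \<in> \<Omega> \<Longrightarrow> laplacian f x = k" and k: "k \<noteq> 0"
    and bd: "\<And>x. x \<in> frontier \<Omega> \<Longrightarrow> norm (grad f x) \<le> c" and x: "x \<in> \<Omega>"
  shows "norm (grad f x) < c"
proof -
  define q where "q = (\<lambda>x. (norm (grad f x))\<^sup>2)"
  have sub: "\<Omega> \<subseteq> U" using \<Omega>(3) closure_subset by blast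
  have fO: "smooth_on \<Omega> f" by (rule smooth_on_subset[OF f sub])
  have no_max: False if y: "y \<in> \<Omega>" and max: "\<And>z. z \<in> \<Omega> \<Longrightarrow> q z \<le> q y" for y
  proof -
    have "fd (laplacian f) y i = 0" for i
    proof -
      have "fd (laplacian f) y = fd (\<lambda>_. k) y" by (rule fd_cong_open[OF \<Omega>(1) y pde])
      then show ?thesis by (simp add: fd_eqI[OF has_derivative_const])
    qed
    then have lq: "laplacian q y = 2 * (\<Sum>j\<in>Basis. \<Sum>i\<in>Basis. (fd (\<lambda>y. fd f y i) y j)\<^sup>2)"
      using laplacian_norm_grad_square(1)[OF \<Omega>(1) y fO] unfolding q_def by simp
    have "laplacian q y \<le> 0" unfolding laplacian_def
      by (intro sum_nonpos second_derivative_nonpos_at_max[where f=q, OF \<Omega>(1) y _ _ max])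
        (use laplacian_norm_grad_square(2,3)[OF \<Omega>(1) y fO] in \<open>simp_all add: q_def\<close>)
    moreover have "(\<Sum>j\<in>Basis. \<Sum>i\<in>Basis. (fd (\<lambda>y. fd f y i) y j)\<^sup>2) > 0"
    proof -
      have "(\<Sum>j\<in>Basis. fd (\<lambda>y. fd f y j) y j) \<noteq> 0" using pde[OF y] k unfolding laplacian_def by simp
      then obtain j where j: "j \<in> (Basis::'a set)" "fd (\<lambda>y. fd f y j) y j \<noteq> 0"
        by (rule sum.not_neutral_contains_not_neutral)
      have "(\<Sum>i\<in>Basis. (fd (\<lambda>y. fd f y i) y j)\<^sup>2) > 0"
        by (rule sum_pos2[OF finite_Basis j(1)]) (simp_all add: j(2))
      then show ?thesis
        by (rule sum_pos2[OF finite_Basis j(1)]) (intro sum_nonneg zero_le_power2)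
    qed
    ultimately show False using lq by simp
  qed
  have cq: "continuous_on (closure \<Omega>) q"
    unfolding q_def
    by (intro continuous_on_power continuous_on_norm
        continuous_on_subset[OF C1_on_continuous[OF C1_on_grad[OF f]] \<Omega>(3)])
  have "compact (closure \<Omega>)" "closure \<Omega> \<noteq> {}" using \<Omega>(2) x by auto
  then obtain z where z: "z \<in> closure \<Omega>" and zmax: "\<And>y. y \<in> closure \<Omega> \<Longrightarrow> q y \<le> q z"
    using continuous_attains_sup[OF _ _ cq] by blast
  have "z \<notin> \<Omega>" using no_max[of z] zmax subsetD[OF closure_subset] by blast
  then have zf: "z \<in> frontier \<Omega>" using z \<Omega>(1) by (simp add: frontier_def interior_open)
  have c0: "0 \<le> c" using order_trans[OF norm_ge_zero bd[OF zf]] .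
  have qz: "q z \<le> c\<^sup>2" unfolding q_def using bd[OF zf] by (intro power_mono) auto
  have "q x \<noteq> q z"
  proof
    assume "q x = q z"
    then have "q y \<le> q x" if "y \<in> \<Omega>" for y using zmax[OF subsetD[OF closure_subset that]] by simp
    then show False using no_max[OF x] by blast
  qed
  moreover have "q x \<le> q z" by (rule zmax[OF subsetD[OF closure_subset x]])
  ultimately have "(norm (grad f x))\<^sup>2 < c\<^sup>2" using qz unfolding q_def by linarith
  then show ?thesis using c0 by (rule power2_less_imp_less)
qed

section \<open>Bounds for the perimeter by calibration\<close>

lemma test_field_iff: "test_field \<phi> \<longleftrightarrow> C1_compact \<phi> \<and> (\<forall>x. norm (\<phi> x) \<le> 1)"
  unfolding test_field_def C1_compact_def C1_on_def by blast

lemma C1_compact_cutoff_scaleR: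
  fixes \<psi> :: "'a::euclidean_space \<Rightarrow> 'b::real_normed_vector"
  assumes U: "open U" "C1_on U \<psi>" and w: "C1_on UNIV w" "compact (closure {x. w x \<noteq> 0})" "closure {x. w x \<noteq> 0} \<subseteq> U"
  shows "C1_compact (\<lambda>x. w x *\<^sub>R \<psi> x)"
  unfolding C1_compact_def
proof
  show "C1_on UNIV (\<lambda>x. w x *\<^sub>R \<psi> x)"
  proof (rule C1_on_locally)
    fix x
    show "\<exists>T. open T \<and> x \<in> T \<and> C1_on T (\<lambda>x. w x *\<^sub>R \<psi> x)"
    proof (cases "x \<in> U")
      case True
      have "C1_on U (\<lambda>x. w x *\<^sub>R \<psi> x)"
        by (rule C1_on_scaleR[OF C1_on_subset[OF w(1) subset_UNIV] U(2)])
      then show ?thesis using True U(1) by (intro exI conjI)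
    next
      case False
      have "C1_on (- closure {x. w x \<noteq> 0}) (\<lambda>x. w x *\<^sub>R \<psi> x)"
      proof (rule C1_on_cong[OF _ C1_on_const[of _ 0]])
        fix x assume "x \<in> - closure {x. w x \<noteq> 0}"
        then have "x \<notin> closure {x. w x \<noteq> 0}" by (rule ComplD)
        then have "x \<notin> {x. w x \<noteq> 0}" by (rule contra_subsetD[OF closure_subset])
        then show "0 = w x *\<^sub>R \<psi> x" by simp
      qed (rule open_Compl[OF closed_closure])
      moreover have "x \<in> - closure {x. w x \<noteq> 0}" using False w(3) by blast
      ultimately show ?thesis using open_Compl[OF closed_closure] by (intro exI conjI)
    qed
  qed
  have "closure {x. w x *\<^sub>R \<psi> x \<noteq> 0} \<subseteq> closure {x. w x \<noteq> 0}" by (intro closure_mono) auto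
  then show "compact (closure {x. w x *\<^sub>R \<psi> x \<noteq> 0})"
    using compact_if_closed_subset[OF closed_closure _ w(2)] by blast
qed

text \<open>Off the closure of \<open>\<Omega>\<close> the field may be slightly longer than one. It is
multiplied by a cutoff supported where its length is below \<open>1 + \<epsilon>\<close> and divided by \<open>1 + \<epsilon>\<close>, which gives a
test field; then \<open>\<epsilon>\<close> tends to zero.\<close>
lemma calibration_le_perimeter:
  fixes \<psi> :: "'a::euclidean_space \<Rightarrow> 'a"
  assumes \<Omega>: "open \<Omega>" "bounded \<Omega>" "closure \<Omega> \<subseteq> U" and U: "open U" and \<psi>: "C1_on U \<psi>"
    and le1: "\<And>x. x \<in> closure \<Omega> \<Longrightarrow> norm (\<psi> x) \<le> 1"
    and E: "E \<subseteq> \<Omega>"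
  shows "ennreal (LINT x:E|lebesgue. divergence \<psi> x) \<le> perimeter E"
proof -
  define I where "I = (LINT x:E|lebesgue. divergence \<psi> x)"
  have step: "ennreal (I / (1 + \<epsilon>)) \<le> perimeter E" if \<epsilon>: "\<epsilon> > 0" for \<epsilon>
  proof -
    define V where "V = U \<inter> (\<lambda>x. norm (\<psi> x)) -` {..<1 + \<epsilon>}"
    have V: "open V"
      unfolding V_def by (intro continuous_open_preimage continuous_on_norm C1_on_continuous[OF \<psi>] U open_lessThan)
    have sub: "closure \<Omega> \<subseteq> V" 
    proof
      fix x assume "x \<in> closure \<Omega>"
      then show "x \<in> V" using le1[of x] \<epsilon> \<Omega>(3) by (auto simp: V_def)
    qed
    have cpt: "compact (closure \<Omega>)" using \<Omega>(2) by simp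
    obtain \<kappa> :: "'a \<Rightarrow> real" where \<kappa>: "C1_on UNIV \<kappa>" "\<And>x. 0 \<le> \<kappa> x" "\<And>x. \<kappa> x \<le> 1"
      "\<And>x. x \<in> closure \<Omega> \<Longrightarrow> \<kappa> x = 1" "compact (closure {x. \<kappa> x \<noteq> 0})" "closure {x. \<kappa> x \<noteq> 0} \<subseteq> V"
      by (rule C1_cutoff[OF cpt V sub]) blast
    define \<phi> where "\<phi> x = \<kappa> x *\<^sub>R ((1 / (1 + \<epsilon>)) *\<^sub>R \<psi> x)" for x
    have \<psi>': "C1_on U (\<lambda>x. (1 / (1 + \<epsilon>)) *\<^sub>R \<psi> x)" by (rule C1_on_scaleR_const[OF \<psi>])
    have "test_field \<phi>" unfolding test_field_iff
    proof (intro conjI allI)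
      show "C1_compact \<phi>" unfolding \<phi>_def[abs_def]
        by (rule C1_compact_cutoff_scaleR[OF U \<psi>' \<kappa>(1,5)]) (use \<kappa>(6) V_def in blast)
      fix x
      show "norm (\<phi> x) \<le> 1"
      proof (cases "x \<in> V")
        case True
        then have "norm (\<psi> x) / (1 + \<epsilon>) \<le> 1" using \<epsilon> by (simp add: V_def)
        then have "\<kappa> x * (norm (\<psi> x) / (1 + \<epsilon>)) \<le> 1 * 1" using \<kappa>(2,3)[of x] \<epsilon> by (intro mult_mono) auto
        then show ?thesis using \<kappa>(2)[of x] \<epsilon> by (simp add: \<phi>_def)
      next
        case False
        then have "\<kappa> x = 0" using \<kappa>(6) closure_subset[of "{x. \<kappa> x \<noteq> 0}"] by blast
        then show ?thesis by (simp add: \<phi>_def)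
      qed
    qed
    then have "ennreal (LINT x:E|lebesgue. divergence \<phi> x) \<le> perimeter E"
      unfolding perimeter_def by (intro SUP_upper) simp
    moreover have "(LINT x:E|lebesgue. divergence \<phi> x) = I / (1 + \<epsilon>)"
    proof -
      have "divergence \<phi> x = divergence \<psi> x / (1 + \<epsilon>)" if "x \<in> E" for x
      proof -
        have xO: "x \<in> \<Omega>" using E that by blast
        have xU: "x \<in> U" using xO \<Omega>(3) closure_subset by blast
        have "divergence \<phi> x = divergence (\<lambda>x. (1 / (1 + \<epsilon>)) *\<^sub>R \<psi> x) x"
          by (rule divergence_cong_open[OF \<Omega>(1) xO]) (simp add: \<phi>_def \<kappa>(4) subsetD[OF closure_subset])
        also have "\<dots> = 1 / (1 + \<epsilon>) * divergence \<psi> x" by (rule divergence_scaleR_const[OF \<psi> xU])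
        finally show ?thesis by simp
      qed
      then have "(LINT x:E|lebesgue. divergence \<phi> x) = (LINT x:E|lebesgue. divergence \<psi> x / (1 + \<epsilon>))"
        unfolding set_lebesgue_integral_def by (intro Bochner_Integration.integral_cong refl) (simp add: indicator_def)
      then show ?thesis unfolding I_def by (simp only: set_integral_divide_zero)
    qed
    ultimately show ?thesis by simp
  qed
  have "ennreal I \<le> perimeter E"
  proof (cases "perimeter E")
    case (real p)
    have "I \<le> p + e" if e: "e > 0" for e
    proof -
      \<comment> \<open>The summand 1 covers the case \<open>p = 0\<close>.\<close>
      define \<epsilon> where "\<epsilon> = e / (p + 1)"
      have \<epsilon>: "\<epsilon> > 0" using e real(1) by (simp add: \<epsilon>_def)
      have "I / (1 + \<epsilon>) \<le> p" using step[OF \<epsilon>] real by (simp add: ennreal_le_iff)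
      then have "I \<le> p * (1 + \<epsilon>)" using \<epsilon> by (simp add: divide_le_eq)
      also have "p * \<epsilon> \<le> e" using e real(1) by (simp add: \<epsilon>_def field_simps)
      then have "p * (1 + \<epsilon>) \<le> p + e" by (simp add: algebra_simps)
      finally show ?thesis .
    qed
    then have "I \<le> p" by (rule field_le_epsilon)
    then show ?thesis using real by (simp add: ennreal_leI)
  qed simp
  then show ?thesis unfolding I_def .
qed

text \<open>Near the boundary \<open>w k\<close> is a step function of \<open>g / \<delta> k\<close>, where \<open>\<delta> k\<close> tends to zero; it is 0 close to the boundary
and 1 on an open set \<open>A\<close> that contains the part of \<open>\<Omega>\<close> not covered by \<open>N\<close>. As \<open>g\<close> has a positive minimum
on the frontier of \<open>A\<close> and \<open>\<delta> k\<close> is less than half of it, the two prescriptions agree there. The last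
conclusion is what calibration arguments need: where it does not vanish, the gradient of \<open>w k\<close> has the
direction of the gradient of \<open>g\<close>.\<close>
lemma approximate_indicator_by_level_sets:
  fixes g :: "'a::euclidean_space \<Rightarrow> real"
  assumes \<Omega>: "open \<Omega>" "bounded \<Omega>" and N: "open N" "frontier \<Omega> \<subseteq> N"
    and g: "C1_on N g" "\<And>x. x \<in> frontier \<Omega> \<Longrightarrow> g x = 0" "\<And>x. x \<in> N \<Longrightarrow> x \<in> \<Omega> \<Longrightarrow> g x > 0"
  obtains w :: "nat \<Rightarrow> 'a \<Rightarrow> real" where
    "\<And>k. C1_on UNIV (w k)" "\<And>k x. 0 \<le> w k x" "\<And>k x. w k x \<le> 1"
    "\<And>k. compact (closure {x. w k x \<noteq> 0})" "\<And>k. closure {x. w k x \<noteq> 0} \<subseteq> \<Omega>"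
    "\<And>x. x \<in> \<Omega> \<Longrightarrow> (\<lambda>k. w k x) \<longlonglongrightarrow> 1"
    "\<And>k x. fd (w k) x = (\<lambda>_. 0) \<or>
      x \<in> N \<and> x \<in> \<Omega> \<and> (\<exists>l\<ge>0. fd (w k) x = (\<lambda>y. l * fd g x y))"
proof -
  have clO: "closure \<Omega> = \<Omega> \<union> frontier \<Omega>" using closure_Un_frontier by blast
  have frO: "frontier \<Omega> \<inter> \<Omega> = {}" using \<Omega>(1) by (simp add: frontier_disjoint_eq)
  have K0: "compact (closure \<Omega> - N)" using \<Omega>(2) N(1) by (intro compact_diff) simp_all
  have K0s: "closure \<Omega> - N \<subseteq> \<Omega>" using N(2) clO by blast
  obtain \<kappa> :: "'a \<Rightarrow> real" where \<kappa>: "C1_on UNIV \<kappa>" "\<And>x. 0 \<le> \<kappa> x" "\<And>x. \<kappa> x \<le> 1"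
      "\<And>x. x \<in> closure \<Omega> - N \<Longrightarrow> \<kappa> x = 1" "compact (closure {x. \<kappa> x \<noteq> 0})" "closure {x. \<kappa> x \<noteq> 0} \<subseteq> \<Omega>"
    by (rule C1_cutoff[OF K0 \<Omega>(1) K0s]) blast
  \<comment> \<open>An open set that contains the closure of \<open>\<Omega>\<close> minus \<open>N\<close> and has compact closure in \<open>\<Omega>\<close>.\<close>
  define A where "A = {x. \<kappa> x > 1/2}"
  have oA: "open A" unfolding A_def by (intro open_Collect_less continuous_on_const C1_on_continuous[OF \<kappa>(1)])
  have cA: "closure A \<subseteq> closure {x. \<kappa> x \<noteq> 0}" unfolding A_def by (intro closure_mono) auto
  then have cAO: "closure A \<subseteq> \<Omega>" using \<kappa>(6) by blast
  have AN: "x \<in> N" if "x \<in> \<Omega>" "x \<notin> A" for x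
    using that \<kappa>(4)[of x] closure_subset[of \<Omega>] unfolding A_def by auto
  have cfr: "compact (frontier A)"
    by (rule compact_if_closed_subset[OF frontier_closed _ \<kappa>(5)]) (use cA in \<open>auto simp: frontier_def\<close>)
  have frA: "frontier A \<subseteq> \<Omega> \<inter> N" "frontier A \<inter> A = {}"
    using cAO AN oA by (auto simp: frontier_def interior_open)
  obtain m where m: "m > 0" "\<And>x. x \<in> frontier A \<Longrightarrow> m \<le> g x"
  proof (cases "frontier A = {}")
    case True then show ?thesis using that[of 1] by auto
  next
    case False
    have "continuous_on (frontier A) g" using continuous_on_subset[OF C1_on_continuous[OF g(1)]] frA(1) by blast
    then obtain z where "z \<in> frontier A" "\<And>y. y \<in> frontier A \<Longrightarrow> g z \<le> g y"
      using continuous_attains_inf[OF cfr False] by blast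
    then show ?thesis using that[of "g z"] g(3)[of z] frA(1) by blast
  qed
  \<comment> \<open>The summand 3 makes \<open>2 * \<delta> k < m\<close> hold for \<open>k = 0\<close> already.\<close>
  define \<delta> where "\<delta> k = m / (real k + 3)" for k
  have \<delta>: "\<delta> k > 0" "2 * \<delta> k < m" for k
  proof -
    show "\<delta> k > 0" using m(1) by (simp add: \<delta>_def)
    have "m * 2 < m * (real k + 3)" using m(1) by (intro mult_strict_left_mono) simp_all
    then show "2 * \<delta> k < m" by (simp add: \<delta>_def divide_less_eq mult.commute)
  qed
  have \<delta>0: "\<delta> \<longlonglongrightarrow> 0"
  proof -
    have "(\<lambda>k. inverse (real (k + 2) + 1)) \<longlonglongrightarrow> 0"
      using LIMSEQ_ignore_initial_segment[OF LIMSEQ_inverse_real_of_nat, of 2] by (simp add: add_ac)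
    from tendsto_mult[OF tendsto_const[of m] this] show ?thesis
      by (simp add: \<delta>_def[abs_def] divide_inverse add_ac)
  qed
  define w where "w k x = (if x \<notin> \<Omega> then 0 else if x \<in> A then 1 else smooth_step ((1 / \<delta> k) * g x))" for k x
  have out: "\<exists>T. open T \<and> x \<in> T \<and> (\<forall>y\<in>T. w k y = 0)" if "x \<notin> \<Omega>" for k x
  proof -
    define T where "T = (- closure \<Omega>) \<union> ((N \<inter> g -` {..<\<delta> k}) - closure A)"
    have "open T" unfolding T_def
      by (intro open_Un open_Diff continuous_open_preimage C1_on_continuous[OF g(1)] N(1)) auto
    moreover have "x \<in> T"
    proof (cases "x \<in> closure \<Omega>")
      case True
      then have "x \<in> frontier \<Omega>" using that clO by blast
      then show ?thesis using N(2) g(2) \<delta>(1)[of k] cAO that by (auto simp: T_def)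
    qed (simp add: T_def)
    moreover have "w k y = 0" if "y \<in> T" for y
    proof (cases "y \<in> \<Omega>")
      case True
      then have "y \<notin> A" "g y < \<delta> k" using that closure_subset[of \<Omega>] closure_subset[of A] unfolding T_def by auto
      moreover have "(1 / \<delta> k) * g y \<le> 1" using calculation(2) \<delta>(1)[of k] by (simp add: field_simps)
      ultimately show ?thesis by (simp add: w_def smooth_step_0)
    qed (simp add: w_def)
    ultimately show ?thesis by blast
  qed
  have loc: "\<exists>T. open T \<and> x \<in> T \<and> ((\<exists>c. \<forall>y\<in>T. w k y = c) \<or>
        T \<subseteq> N \<inter> \<Omega> \<and> (\<forall>y\<in>T. w k y = smooth_step ((1 / \<delta> k) * g y)))" for k x
  proof -
    consider "x \<notin> \<Omega>" | "x \<in> A" | "x \<in> \<Omega> - closure A" | "x \<in> frontier A"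
      using oA by (auto simp: frontier_def interior_open)
    then show ?thesis
    proof cases
      case 1 then show ?thesis using out[of x k] by blast
    next
      case 2
      have "\<forall>y\<in>A. w k y = 1" using cAO closure_subset[of A] by (auto simp: w_def)
      then show ?thesis using 2 oA by blast
    next
      case 3
      have "\<Omega> - closure A \<subseteq> N \<inter> \<Omega>" using AN closure_subset[of A] by blast
      moreover have "\<forall>y\<in>\<Omega> - closure A. w k y = smooth_step ((1 / \<delta> k) * g y)"
        using closure_subset[of A] by (auto simp: w_def)
      moreover have "open (\<Omega> - closure A)" using \<Omega>(1) by (simp add: open_Diff)
      ultimately show ?thesis using 3 by blast
    next
      case 4
      define T where "T = \<Omega> \<inter> (N \<inter> g -` {2 * \<delta> k<..})"
      have "open T" unfolding T_def
        by (intro open_Int continuous_open_preimage C1_on_continuous[OF g(1)] N(1) \<Omega>(1) open_greaterThan)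
      moreover have "x \<in> T" using 4 frA(1) m(2)[OF 4] \<delta>(2)[of k] by (auto simp: T_def)
      moreover have "\<forall>y\<in>T. w k y = 1"
      proof
        fix y assume y: "y \<in> T"
        then have "2 \<le> (1 / \<delta> k) * g y" using \<delta>(1)[of k] by (simp add: T_def field_simps)
        then show "w k y = 1" using y by (simp add: w_def smooth_step_1 T_def)
      qed
      ultimately show ?thesis by blast
    qed
  qed
  have C1s: "C1_on T (\<lambda>y. smooth_step ((1 / \<delta> k) * g y))" if "T \<subseteq> N" for T k
    using C1_on_smooth_step[OF C1_on_mult[OF C1_on_const C1_on_subset[OF g(1) that]]] .
  have wC1: "C1_on UNIV (w k)" for k
  proof (rule C1_on_locally)
    fix x
    obtain T where T: "open T" "x \<in> T" and
      alt: "(\<exists>c. \<forall>y\<in>T. w k y = c) \<or> T \<subseteq> N \<inter> \<Omega> \<and> (\<forall>y\<in>T. w k y = smooth_step ((1 / \<delta> k) * g y))"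
      using loc[of x k] by blast
    from alt have "C1_on T (w k)"
    proof (elim disjE exE conjE)
      fix c assume "\<forall>y\<in>T. w k y = c"
      then show ?thesis by (intro C1_on_cong[OF T(1) C1_on_const[of T c]]) simp
    next
      assume a: "T \<subseteq> N \<inter> \<Omega>" "\<forall>y\<in>T. w k y = smooth_step ((1 / \<delta> k) * g y)"
      have "T \<subseteq> N" using a(1) by blast
      then show ?thesis using a(2) by (intro C1_on_cong[OF T(1) C1s[of T k]]) simp_all
    qed
    then show "\<exists>T. open T \<and> x \<in> T \<and> C1_on T (w k)" using T by blast
  qed
  have supp: "closure {x. w k x \<noteq> 0} \<subseteq> \<Omega>" for k
  proof
    fix x assume x: "x \<in> closure {x. w k x \<noteq> 0}"
    show "x \<in> \<Omega>"
    proof (rule ccontr)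
      assume "x \<notin> \<Omega>"
      from out[OF this, of k] obtain T where T: "open T" "x \<in> T" "\<forall>y\<in>T. w k y = 0" by blast
      then have "T \<inter> {x. w k x \<noteq> 0} = {}" by blast
      then show False using open_Int_closure_eq_empty[OF T(1)] x T(2) by blast
    qed
  qed
  show ?thesis
  proof (rule that[of w])
    show "C1_on UNIV (w k)" "closure {x. w k x \<noteq> 0} \<subseteq> \<Omega>" for k by (rule wC1, rule supp)
    show "0 \<le> w k x" "w k x \<le> 1" for k x by (simp_all add: w_def smooth_step_bounds)
    show "compact (closure {x. w k x \<noteq> 0})" for k
      using bounded_subset[OF \<Omega>(2) order_trans[OF closure_subset supp]] by (simp add: compact_closure)
    show "(\<lambda>k. w k x) \<longlonglongrightarrow> 1" if "x \<in> \<Omega>" for x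
    proof (cases "x \<in> A")
      case True then show ?thesis using that by (simp add: w_def)
    next
      case False
      have gx: "g x > 0" using g(3) AN that False by blast
      have "\<forall>\<^sub>F k in sequentially. \<delta> k < g x / 2" using order_tendstoD(2)[OF \<delta>0, of "g x / 2"] gx by simp
      then have "\<forall>\<^sub>F k in sequentially. w k x = 1"
      proof (rule eventually_mono)
        fix k assume "\<delta> k < g x / 2"
        then have "2 \<le> (1 / \<delta> k) * g x" using \<delta>(1)[of k] by (simp add: field_simps)
        then show "w k x = 1" by (simp add: w_def smooth_step_1 that)
      qed
      then show ?thesis by (rule tendsto_eventually)
    qed
    fix k x
    obtain T where T: "open T" "x \<in> T" and
      alt: "(\<exists>c. \<forall>y\<in>T. w k y = c) \<or> T \<subseteq> N \<inter> \<Omega> \<and> (\<forall>y\<in>T. w k y = smooth_step ((1 / \<delta> k) * g y))"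
      using loc[of x k] by blast
    from alt show "fd (w k) x = (\<lambda>_. 0) \<or> x \<in> N \<and> x \<in> \<Omega> \<and> (\<exists>l\<ge>0. fd (w k) x = (\<lambda>y. l * fd g x y))"
    proof (elim disjE exE conjE)
      fix c assume c: "\<forall>y\<in>T. w k y = c"
      have "fd (w k) x = fd (\<lambda>_. c) x" by (rule fd_cong_open[OF T]) (use c in blast)
      then show ?thesis by (simp add: fd_eqI[OF has_derivative_const])
    next
      assume a: "T \<subseteq> N \<inter> \<Omega>" "\<forall>y\<in>T. w k y = smooth_step ((1 / \<delta> k) * g y)"
      have xN: "x \<in> N" "x \<in> \<Omega>" using a(1) T(2) by auto
      have "fd (w k) x = fd (\<lambda>y. smooth_step ((1 / \<delta> k) * g y)) x" by (rule fd_cong_open[OF T]) (use a in blast)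
      also have "\<dots> = (\<lambda>y. smooth_step' ((1 / \<delta> k) * g x) * ((1 / \<delta> k) * fd g x y))"
        by (rule fd_eqI) (rule has_derivative_compose[OF has_derivative_mult_right[OF C1_on_has_derivative[OF g(1) xN(1)]]
            smooth_step_has_derivative[unfolded has_field_derivative_def]])
      finally have "fd (w k) x = (\<lambda>y. (smooth_step' ((1 / \<delta> k) * g x) * (1 / \<delta> k)) * fd g x y)"
        by (simp add: mult.assoc)
      moreover have "0 \<le> smooth_step' ((1 / \<delta> k) * g x) * (1 / \<delta> k)"
        using smooth_step'_nonneg \<delta>(1)[of k] by (intro mult_nonneg_nonneg) simp_all
      ultimately show ?thesis using xN by blast
    qed
  qed
qed

text \<open>With \<open>w\<close> as in the approximation lemma and \<open>b < c\<close>, shrink \<open>N\<close> so that \<open>|X| > b\<close> on it. As \<open>\<nabla>w\<close> is a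
nonnegative multiple of \<open>X\<close>, a test field satisfies
\<open>-\<nabla>w \<cdot> \<phi> \<le> |\<nabla>w| \<le> \<nabla>w \<cdot> X / b\<close>. Integration by parts turns the left-hand side into the integral
of \<open>w div \<phi>\<close> and the right-hand side into that of \<open>w / b\<close>, because \<open>div X = -1\<close>. Letting \<open>w\<close> tend to the
indicator of \<open>\<Omega>\<close> and then \<open>b\<close> to \<open>c\<close> gives the bound.\<close>
lemma perimeter_le_calibrated:
  fixes X :: "'a::euclidean_space \<Rightarrow> 'a" and g :: "'a \<Rightarrow> real"
  assumes \<Omega>: "open \<Omega>" "bounded \<Omega>" "closure \<Omega> \<subseteq> U" and U: "open U" and X: "C1_on U X"
    and div: "\<And>x. x \<in> \<Omega> \<Longrightarrow> divergence X x = - 1"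
    and N: "open N" "frontier \<Omega> \<subseteq> N" "N \<subseteq> U"
    and g: "C1_on N g" "\<And>x. x \<in> frontier \<Omega> \<Longrightarrow> g x = 0" "\<And>x. x \<in> N \<Longrightarrow> x \<in> \<Omega> \<Longrightarrow> g x > 0"
    and gX: "\<And>x y. x \<in> N \<Longrightarrow> fd g x y = X x \<bullet> y"
    and c: "c > 0" "\<And>x. x \<in> frontier \<Omega> \<Longrightarrow> norm (X x) = c"
  shows "perimeter \<Omega> \<le> ennreal (measure lebesgue \<Omega> / c)"
  unfolding perimeter_def
proof (rule SUP_least)
  fix \<phi> :: "'a \<Rightarrow> 'a" assume "\<phi> \<in> Collect test_field"
  then have \<phi>: "C1_compact \<phi>" and \<phi>1: "\<And>x. norm (\<phi> x) \<le> 1" by (auto simp: test_field_iff)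
  have \<phi>C1: "C1_on UNIV \<phi>" using \<phi> by (simp add: C1_compact_def)
  define m where "m = measure lebesgue \<Omega>"
  have Om: "\<Omega> \<in> lmeasurable" using lmeasurable_open[OF \<Omega>(2,1)] .
  have int\<Omega>: "integrable lebesgue (indicator \<Omega> :: 'a \<Rightarrow> real)" 
    by (rule integrable_real_indicator) (use Om in \<open>auto simp: fmeasurable_def\<close>)
  define I where "I = (LINT x:\<Omega>|lebesgue. divergence \<phi> x)"
  have int\<phi>: "integrable lebesgue (divergence \<phi>)"
    using set_integrable_divergence[OF \<phi>, of UNIV] by (simp add: set_integrable_def)
  have bound: "I \<le> m / b" if b: "0 < b" "b < c" for b
  proof -
    define N' where "N' = N \<inter> (\<lambda>x. norm (X x)) -` {b<..}"
    have oN': "open N'" unfolding N'_def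
      by (intro continuous_open_preimage continuous_on_norm continuous_on_subset[OF C1_on_continuous[OF X] N(3)] N(1) open_greaterThan)
    have fN': "frontier \<Omega> \<subseteq> N'" unfolding N'_def using N(2) c(2) b(2) by auto
    have N'N: "N' \<subseteq> N" by (auto simp: N'_def)
    show ?thesis
    proof (rule approximate_indicator_by_level_sets[OF \<Omega>(1,2) oN' fN' C1_on_subset[OF g(1) N'N] g(2) g(3)[OF subsetD[OF N'N]]])
      fix w :: "nat \<Rightarrow> 'a \<Rightarrow> real"
      assume w: "\<And>k. C1_on UNIV (w k)" "\<And>k x. 0 \<le> w k x" "\<And>k x. w k x \<le> 1"
        "\<And>k. compact (closure {x. w k x \<noteq> 0})" "\<And>k. closure {x. w k x \<noteq> 0} \<subseteq> \<Omega>"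
        "\<And>x. x \<in> \<Omega> \<Longrightarrow> (\<lambda>k. w k x) \<longlonglongrightarrow> 1"
        "\<And>k x. fd (w k) x = (\<lambda>_. 0) \<or>
          x \<in> N' \<and> x \<in> \<Omega> \<and> (\<exists>l\<ge>0. fd (w k) x = (\<lambda>y. l * fd g x y))"
      have wO: "w k x = 0" if "x \<notin> \<Omega>" for k x
        using that w(5)[of k] closure_subset[of "{x. w k x \<noteq> 0}"] by blast
      have le: "(LINT x|lebesgue. w k x * divergence \<phi> x) \<le> m / b" for k
      proof -
        have iw: "integrable lebesgue (w k)"
          by (rule integrable_continuous_compact_support[OF C1_on_continuous[OF w(1)] w(4)[of k]])
            (use closure_subset[of "{x. w k x \<noteq> 0}"] in auto)
        have supU: "closure {x. w k x \<noteq> 0} \<subseteq> U" using w(5)[of k] \<Omega>(3) closure_subset[of \<Omega>] by blast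
        have W\<phi>: "C1_compact (\<lambda>x. w k x *\<^sub>R \<phi> x)"
          by (rule C1_compact_cutoff_scaleR[OF open_UNIV \<phi>C1 w(1) w(4) subset_UNIV])
        have WX: "C1_compact (\<lambda>x. w k x *\<^sub>R X x)"
          by (rule C1_compact_cutoff_scaleR[OF U X w(1) w(4) supU])
        have div\<phi>: "divergence (\<lambda>x. w k x *\<^sub>R \<phi> x) x = w k x * divergence \<phi> x + fd (w k) x (\<phi> x)" for x
          by (rule divergence_scaleR[OF w(1) \<phi>C1 UNIV_I])
        have divX: "divergence (\<lambda>x. w k x *\<^sub>R X x) x = fd (w k) x (X x) - w k x" for x
        proof (cases "x \<in> \<Omega>")
          case True
          then have "x \<in> U" using \<Omega>(3) closure_subset by blast
          from divergence_scaleR[OF C1_on_subset[OF w(1) subset_UNIV] X this]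
          show ?thesis using div[OF True] by simp
        next
          case False
          then have "x \<notin> closure {x. w k x \<noteq> 0}" using w(5)[of k] by blast
          moreover have "closure {x. w k x *\<^sub>R X x \<noteq> 0} \<subseteq> closure {x. w k x \<noteq> 0}" by (intro closure_mono) auto
          ultimately show ?thesis
            using fd_outside_support[of x "w k"] divergence_outside_support[of x "\<lambda>x. w k x *\<^sub>R X x"] wO[OF False] by auto
        qed
        have i\<phi>: "integrable lebesgue (\<lambda>x. w k x * divergence \<phi> x)"
          by (rule integrable_continuous_compact_support[OF _ w(4)[of k]])
            (intro continuous_on_mult C1_on_continuous[OF w(1)] continuous_on_divergence[OF \<phi>C1],
              use closure_subset[of "{x. w k x \<noteq> 0}"] in auto)
        have iW\<phi>: "integrable lebesgue (divergence (\<lambda>x. w k x *\<^sub>R \<phi> x))"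
          using set_integrable_divergence[OF W\<phi>, of UNIV] by (simp add: set_integrable_def)
        have iWX: "integrable lebesgue (divergence (\<lambda>x. w k x *\<^sub>R X x))"
          using set_integrable_divergence[OF WX, of UNIV] by (simp add: set_integrable_def)
        have fd\<phi>: "- fd (w k) x (\<phi> x) = w k x * divergence \<phi> x - divergence (\<lambda>x. w k x *\<^sub>R \<phi> x) x" for x
          by (simp add: div\<phi>)
        have fdX: "fd (w k) x (X x) = divergence (\<lambda>x. w k x *\<^sub>R X x) x + w k x" for x
          by (simp add: divX)
        have pt: "- fd (w k) x (\<phi> x) \<le> fd (w k) x (X x) / b" for x
          using w(7)[where k=k and x=x]
        proof (elim disjE conjE exE)
          fix l assume x: "x \<in> N'" and l: "0 \<le> l" "fd (w k) x = (\<lambda>y. l * fd g x y)"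
          have xN: "x \<in> N" using x N'N by blast
          have "b \<le> norm (X x)" using x by (simp add: N'_def)
          then have "b * norm (X x) \<le> norm (X x) * norm (X x)" by (intro mult_right_mono) auto
          then have 1: "norm (X x) \<le> (X x \<bullet> X x) / b"
            using b(1) by (simp add: pos_le_divide_eq mult.commute norm_eq_sqrt_inner)
          have "- (X x \<bullet> \<phi> x) \<le> norm (X x) * norm (\<phi> x)" using Cauchy_Schwarz_ineq2[of "X x" "\<phi> x"] by linarith
          also have "\<dots> \<le> norm (X x) * 1" by (intro mult_left_mono \<phi>1) auto
          finally have "- (X x \<bullet> \<phi> x) \<le> (X x \<bullet> X x) / b" using 1 by linarith
          from mult_left_mono[OF this l(1)] show ?thesis by (simp add: l(2) gX[OF xN])
        qed simp
        have "(LINT x|lebesgue. w k x * divergence \<phi> x) = (LINT x|lebesgue. - fd (w k) x (\<phi> x))"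
          unfolding fd\<phi> using integral_divergence_eq_0[OF W\<phi>]
          by (simp add: Bochner_Integration.integral_diff[OF i\<phi> iW\<phi>])
        also have "\<dots> \<le> (LINT x|lebesgue. fd (w k) x (X x) / b)"
        proof (rule integral_mono[OF _ _ pt])
          show "integrable lebesgue (\<lambda>x. - fd (w k) x (\<phi> x))" unfolding fd\<phi> by (intro Bochner_Integration.integrable_diff i\<phi> iW\<phi>)
          show "integrable lebesgue (\<lambda>x. fd (w k) x (X x) / b)" unfolding fdX
            by (intro integrable_divide_zero impI Bochner_Integration.integrable_add iWX iw)
        qed
        also have "\<dots> = (LINT x|lebesgue. w k x) / b"
          unfolding fdX using integral_divergence_eq_0[OF WX]
          by (simp add: Bochner_Integration.integral_add[OF iWX iw])
        also have "(LINT x|lebesgue. w k x) \<le> (LINT x|lebesgue. indicator \<Omega> x)"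
          by (rule integral_mono[OF iw int\<Omega>]) (use w(3) wO in \<open>auto simp: indicator_def\<close>)
        then have "(LINT x|lebesgue. w k x) / b \<le> m / b" using b(1) by (simp add: m_def divide_right_mono)
        finally show ?thesis .
      qed
      have "(\<lambda>k. LINT x|lebesgue. w k x * divergence \<phi> x) \<longlonglongrightarrow> (LINT x|lebesgue. indicator \<Omega> x *\<^sub>R divergence \<phi> x)"
      proof (rule integral_dominated_convergence[where w="\<lambda>x. norm (divergence \<phi> x)"])
        show "(\<lambda>x. indicator \<Omega> x *\<^sub>R divergence \<phi> x) \<in> borel_measurable lebesgue"
          using integrable_mult_indicator[OF _ int\<phi>, of \<Omega>] Om by auto
        show "(\<lambda>x. w k x * divergence \<phi> x) \<in> borel_measurable lebesgue" for k
        proof -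
          have "w k \<in> borel_measurable lebesgue"
            using borel_measurable_continuous_onI[OF C1_on_continuous[OF w(1)[of k]]] by (simp add: measurable_completion)
          then show ?thesis using int\<phi> by (intro borel_measurable_times) auto
        qed
        show "integrable lebesgue (\<lambda>x. norm (divergence \<phi> x))" using int\<phi> by (rule integrable_norm)
        show "AE x in lebesgue. (\<lambda>k. w k x * divergence \<phi> x) \<longlonglongrightarrow> indicator \<Omega> x *\<^sub>R divergence \<phi> x"
        proof (rule AE_I2)
          fix x
          have "(\<lambda>k. w k x) \<longlonglongrightarrow> indicator \<Omega> x"
            using w(6)[of x] wO[of x] by (cases "x \<in> \<Omega>") auto
          then show "(\<lambda>k. w k x * divergence \<phi> x) \<longlonglongrightarrow> indicator \<Omega> x *\<^sub>R divergence \<phi> x"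
            by (simp add: tendsto_mult_right)
        qed
        show "AE x in lebesgue. norm (w k x * divergence \<phi> x) \<le> norm (divergence \<phi> x)" for k
        proof (rule AE_I2)
          fix x
          show "norm (w k x * divergence \<phi> x) \<le> norm (divergence \<phi> x)"
            using mult_right_mono[OF w(3)[of k x], of "\<bar>divergence \<phi> x\<bar>"] w(2)[of k x] by (simp add: abs_mult)
        qed
      qed
      from LIMSEQ_le_const2[OF this] show ?thesis using le unfolding I_def set_lebesgue_integral_def by blast
    qed
  qed
  have "I \<le> m / c"
  proof (rule ccontr)
    assume "\<not> ?thesis"
    then have gt: "m / c < I" by simp
    have m0: "m \<ge> 0" by (simp add: m_def)
    have I0: "I > 0" using gt m0 c(1) by (meson divide_nonneg_pos le_less_trans)
    have "m / I < c" using gt I0 c(1) by (simp add: field_simps)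
    then obtain b where b: "m / I < b" "b < c" using dense by blast
    have b0: "b > 0" using b(1) m0 I0 by (meson divide_nonneg_pos le_less_trans)
    have "I \<le> m / b" by (rule bound[OF b0 b(2)])
    then have "I * b \<le> m" using b0 by (simp add: pos_le_divide_eq)
    moreover have "m < I * b" using b(1) I0 by (simp add: pos_divide_less_eq mult.commute)
    ultimately show False by simp
  qed
  then show "ennreal (LINT x:\<Omega>|lebesgue. divergence \<phi> x) \<le> ennreal (measure lebesgue \<Omega> / c)"
    unfolding I_def m_def by (rule ennreal_leI)
qed

section \<open>Sets whose indicator function is weakly constant\<close>

lemma C1_compact_translate:
  fixes f :: "'a::euclidean_space \<Rightarrow> real"
  assumes f: "C1_compact f"
  shows "C1_compact (\<lambda>x. f (x + a))" and "fd (\<lambda>x. f (x + a)) x = fd f (x + a)"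
    and "closure {x. f (x + a) \<noteq> 0} = (\<lambda>x. x - a) ` closure {x. f x \<noteq> 0}"
proof -
  have fC1: "C1_on UNIV f" and K: "compact (closure {x. f x \<noteq> 0})" using f by (auto simp: C1_compact_def)
  have d: "((\<lambda>x. f (x + a)) has_derivative fd f (x + a)) (at x)" for x
  proof -
    have "((\<lambda>x. x + a) has_derivative (\<lambda>y. y)) (at x)" by (auto intro!: derivative_eq_intros)
    from has_derivative_compose[OF this C1_on_has_derivative[OF fC1 UNIV_I]] show ?thesis .
  qed
  show "fd (\<lambda>x. f (x + a)) x = fd f (x + a)" by (rule fd_eqI[OF d])
  have "{x. f (x + a) \<noteq> 0} = (\<lambda>x. - a + x) ` {x. f x \<noteq> 0}"
  proof (intro set_eqI iffI)
    fix x assume "x \<in> {x. f (x + a) \<noteq> 0}"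
    then show "x \<in> (\<lambda>x. - a + x) ` {x. f x \<noteq> 0}" by (intro image_eqI[of _ _ "x + a"]) simp_all
  next
    fix x assume "x \<in> (\<lambda>x. - a + x) ` {x. f x \<noteq> 0}"
    then obtain y where "x = - a + y" "f y \<noteq> 0" by blast
    then show "x \<in> {x. f (x + a) \<noteq> 0}" by simp
  qed
  then have cl: "closure {x. f (x + a) \<noteq> 0} = (\<lambda>x. - a + x) ` closure {x. f x \<noteq> 0}"
    by (simp only: closure_translation)
  have "(\<lambda>x. - a + x) = (\<lambda>x. x - a)" by (rule ext) simp
  then show "closure {x. f (x + a) \<noteq> 0} = (\<lambda>x. x - a) ` closure {x. f x \<noteq> 0}" by (simp only: cl)
  show "C1_compact (\<lambda>x. f (x + a))" unfolding C1_compact_def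
  proof
    show "C1_on UNIV (\<lambda>x. f (x + a))"
    proof (rule C1_onI[OF d])
      show "continuous_on UNIV (\<lambda>x. fd f (x + a) v)" for v
        by (rule continuous_on_compose2[OF C1_on_continuous_fd[OF fC1]])
          (intro continuous_intros subset_UNIV)+
    qed
    show "compact (closure {x. f (x + a) \<noteq> 0})" unfolding cl by (rule compact_translation[OF K])
  qed
qed

text \<open>The distributional gradient of the indicator function of \<open>E\<close> vanishes in \<open>\<Omega>\<close>.\<close>
definition weakly_constant_on :: "'a::euclidean_space set \<Rightarrow> 'a set \<Rightarrow> bool" where
  "weakly_constant_on \<Omega> E \<longleftrightarrow> (\<forall>\<psi>. C1_compact \<psi> \<longrightarrow> closure {x. \<psi> x \<noteq> 0} \<subseteq> \<Omega> \<longrightarrow>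
     (LINT x:E|lebesgue. divergence \<psi> x) = 0)"

lemma weakly_constant_on_fd:
  fixes f :: "'a::euclidean_space \<Rightarrow> real"
  assumes E: "weakly_constant_on \<Omega> E" and f: "C1_compact f" "closure {x. f x \<noteq> 0} \<subseteq> \<Omega>"
  shows "(LINT x:E|lebesgue. fd f x h) = 0"
proof -
  have fC1: "C1_on UNIV f" and K: "compact (closure {x. f x \<noteq> 0})" using f by (auto simp: C1_compact_def)
  have sub: "closure {x. f x *\<^sub>R h \<noteq> 0} \<subseteq> closure {x. f x \<noteq> 0}" by (intro closure_mono) auto
  have "C1_compact (\<lambda>x. f x *\<^sub>R h)" unfolding C1_compact_def
    using C1_on_scaleR[OF fC1 C1_on_const] compact_if_closed_subset[OF closed_closure sub K] by blast
  then have "(LINT x:E|lebesgue. divergence (\<lambda>x. f x *\<^sub>R h) x) = 0"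
    using E order_trans[OF sub f(2)] unfolding weakly_constant_on_def by blast
  moreover have "divergence (\<lambda>x. f x *\<^sub>R h) x = fd f x h" for x
    using divergence_scaleR[OF fC1 C1_on_const UNIV_I, of h x]
    by (simp add: divergence_def fd_eqI[OF has_derivative_const])
  ultimately show ?thesis by simp
qed

text \<open>By convexity all intermediate translates stay supported in \<open>B\<close>, so the integral over \<open>E\<close> has
derivative zero along the translation.\<close>
lemma weakly_constant_on_translate:
  fixes f :: "'a::euclidean_space \<Rightarrow> real"
  assumes E: "E \<in> sets lebesgue" "weakly_constant_on \<Omega> E" and f: "C1_compact f"
    and B: "convex B" "B \<subseteq> \<Omega>" "closure {x. f x \<noteq> 0} \<subseteq> B" "\<And>x. x \<in> closure {x. f x \<noteq> 0} \<Longrightarrow> x - h \<in> B"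
  shows "(LINT x:E|lebesgue. f (x + h)) = (LINT x:E|lebesgue. f x)"
proof -
  define F where "F t = (LINT x:E|lebesgue. f (x + t *\<^sub>R h))" for t
  have D: "(F has_real_derivative (LINT x:E|lebesgue. fd f (x + t *\<^sub>R h) h)) (at t)" for t
    unfolding F_def by (rule set_integral_translate_has_derivative[OF f E(1)])
  have "F 1 = F 0"
  proof (rule DERIV_isconst_end[of 0 1 F])
    show "continuous_on {0..1} F"
      using D by (intro continuous_at_imp_continuous_on ballI) (rule DERIV_isCont)
    fix t :: real assume t: "0 < t" "t < 1"
    have "closure {x. f (x + t *\<^sub>R h) \<noteq> 0} \<subseteq> \<Omega>"
      unfolding C1_compact_translate(3)[OF f]
    proof (rule image_subsetI)
      fix x assume x: "x \<in> closure {x. f x \<noteq> 0}"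
      have "(1 - t) *\<^sub>R x + t *\<^sub>R (x - h) \<in> B"
        using t by (intro convexD[OF B(1)] subsetD[OF B(3) x] B(4)[OF x]) simp_all
      moreover have "(1 - t) *\<^sub>R x + t *\<^sub>R (x - h) = x - t *\<^sub>R h" by (simp add: algebra_simps)
      ultimately show "x - t *\<^sub>R h \<in> \<Omega>" using B(2) by auto
    qed
    from weakly_constant_on_fd[OF E(2) C1_compact_translate(1)[OF f] this, of h]
    have "(LINT x:E|lebesgue. fd f (x + t *\<^sub>R h) h) = 0"
      by (simp only: C1_compact_translate(2)[OF f])
    then show "(F has_real_derivative 0) (at t)" using D[of t] by simp
  qed simp
  then show ?thesis by (simp add: F_def)
qed

lemma set_integral_tendsto_indicator:
  fixes f :: "nat \<Rightarrow> 'a::euclidean_space \<Rightarrow> real"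
  assumes E: "E \<in> sets lebesgue" and S: "bounded S" "S \<in> sets lebesgue" and T: "T \<in> sets lebesgue"
    and f: "\<And>k. continuous_on UNIV (f k)" "\<And>k x. \<bar>f k x\<bar> \<le> indicator S x" "\<And>x. (\<lambda>k. f k x) \<longlonglongrightarrow> indicator T x"
  shows "(\<lambda>k. LINT x:E|lebesgue. f k x) \<longlonglongrightarrow> measure lebesgue (E \<inter> T)"
proof -
  have "(\<lambda>k. LINT x|lebesgue. indicator E x *\<^sub>R f k x) \<longlonglongrightarrow> (LINT x|lebesgue. indicator (E \<inter> T) x)"
  proof (rule integral_dominated_convergence[where w="indicator S"])
    show "indicator (E \<inter> T) \<in> borel_measurable lebesgue" using E T by (intro borel_measurable_indicator) auto
    show "(\<lambda>x. indicator E x *\<^sub>R f k x) \<in> borel_measurable lebesgue" for k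
    proof -
      have "f k \<in> borel_measurable lebesgue"
        using borel_measurable_continuous_onI[OF f(1)] by (simp add: measurable_completion)
      then show ?thesis using E by (intro borel_measurable_scaleR borel_measurable_indicator) auto
    qed
    show "integrable lebesgue (indicator S :: 'a \<Rightarrow> real)"
      by (rule integrable_real_indicator[OF S(2)])
        (use bounded_set_imp_lmeasurable[OF S] in \<open>auto simp: fmeasurable_def\<close>)
    show "AE x in lebesgue. (\<lambda>k. indicator E x *\<^sub>R f k x) \<longlonglongrightarrow> indicator (E \<inter> T) x"
      by (rule AE_I2) (use tendsto_scaleR[OF tendsto_const f(3)] in \<open>simp add: indicator_inter_arith\<close>)
    show "AE x in lebesgue. norm (indicator E x *\<^sub>R f k x) \<le> indicator S x" for k
    proof (rule AE_I2)
      fix x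
      have "norm (indicator E x *\<^sub>R f k x) \<le> \<bar>f k x\<bar>" by (simp add: indicator_def)
      then show "norm (indicator E x *\<^sub>R f k x) \<le> indicator S x" using f(2)[of k x] by linarith
    qed
  qed
  then show ?thesis by (simp add: set_lebesgue_integral_def)
qed

text \<open>The previous invariance, applied to cutoffs that converge to the indicator of \<open>K\<close>.\<close>
lemma weakly_constant_on_measure_translate:
  fixes K :: "'a::euclidean_space set"
  assumes E: "E \<in> sets lebesgue" "weakly_constant_on \<Omega> E"
    and B: "convex B" "open B" "bounded B" "B \<subseteq> \<Omega>"
    and K: "compact K" "K \<subseteq> B" "\<And>x. x \<in> K \<Longrightarrow> x + h \<in> B"
  shows "measure lebesgue (E \<inter> K) = measure lebesgue (E \<inter> (\<lambda>x. x + h) ` K)"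
proof -
  define V where "V k = B \<inter> (\<lambda>x. x + h) -` B \<inter> (\<Union>y\<in>K. ball y (1 / (real k + 1)))" for k
  have oV: "open (V k)" for k
    unfolding V_def by (intro open_Int open_UN ballI open_ball B(2) open_vimage continuous_intros)
  have KV: "K \<subseteq> V k" for k
  proof
    fix x assume x: "x \<in> K"
    then have "x \<in> ball x (1 / (real k + 1))" by (simp add: add_nonneg_pos)
    then show "x \<in> V k" using x K(2,3) unfolding V_def by blast
  qed
  have "\<forall>k. \<exists>f :: 'a \<Rightarrow> real. C1_compact f \<and> (\<forall>x. 0 \<le> f x \<and> f x \<le> 1) \<and> (\<forall>x\<in>K. f x = 1) \<and> closure {x. f x \<noteq> 0} \<subseteq> V k"
  proof
    fix k
    show "\<exists>f :: 'a \<Rightarrow> real. C1_compact f \<and> (\<forall>x. 0 \<le> f x \<and> f x \<le> 1) \<and> (\<forall>x\<in>K. f x = 1) \<and> closure {x. f x \<noteq> 0} \<subseteq> V k"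
      by (rule C1_cutoff[OF K(1) oV KV]) (unfold C1_compact_def, blast)
  qed
  then obtain f :: "nat \<Rightarrow> 'a \<Rightarrow> real" where fall: "\<forall>k. C1_compact (f k) \<and> (\<forall>x. 0 \<le> f k x \<and> f k x \<le> 1) \<and>
      (\<forall>x\<in>K. f k x = 1) \<and> closure {x. f k x \<noteq> 0} \<subseteq> V k"
    by (rule choice[THEN exE])
  then have fC: "C1_compact (f k)" and f01: "0 \<le> f k x" "f k x \<le> 1" and f1: "x \<in> K \<Longrightarrow> f k x = 1"
    and fV: "closure {x. f k x \<noteq> 0} \<subseteq> V k" for k x by blast+
  have f0: "f k x = 0" if "x \<notin> V k" for k x
    using fV[of k] closure_subset[of "{x. f k x \<noteq> 0}"] that by blast
  have lim: "(\<lambda>k. f k x) \<longlonglongrightarrow> indicator K x" for x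
  proof (cases "x \<in> K")
    case True then show ?thesis by (simp add: f1)
  next
    case False
    have "open (- K)" using compact_imp_closed[OF K(1)] by blast
    then obtain e where e: "e > 0" "ball x e \<subseteq> - K" using False open_contains_ball by blast
    have "\<forall>\<^sub>F k in sequentially. inverse (real (Suc k)) < e"
      using order_tendstoD(2)[OF LIMSEQ_inverse_real_of_nat e(1)] .
    then have "\<forall>\<^sub>F k in sequentially. f k x = 0"
    proof (rule eventually_mono)
      fix k assume k: "inverse (real (Suc k)) < e"
      have "x \<notin> V k"
      proof
        assume "x \<in> V k"
        then obtain y where y: "y \<in> K" "dist y x < 1 / (real k + 1)" unfolding V_def by auto
        then have "y \<in> ball x e" using k by (simp add: dist_commute inverse_eq_divide add.commute)
        then show False using e(2) y(1) by blast
      qed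
      then show "f k x = 0" by (rule f0)
    qed
    then show ?thesis using False by (simp add: tendsto_eventually)
  qed
  have cf: "continuous_on UNIV (f k)" for k using fC C1_on_continuous unfolding C1_compact_def by blast
  have Km: "K \<in> sets lebesgue" "(\<lambda>x. x + h) ` K \<in> sets lebesgue" "B \<in> sets lebesgue"
  proof -
    have "compact ((\<lambda>x. x + h) ` K)" by (rule compact_continuous_image[OF _ K(1)]) (intro continuous_intros)
    then show "K \<in> sets lebesgue" "(\<lambda>x. x + h) ` K \<in> sets lebesgue" "B \<in> sets lebesgue"
      using borel_compact[OF K(1)] borel_compact[of "(\<lambda>x. x + h) ` K"] B(2) by simp_all
  qed
  have fB: "f k x \<le> indicator B x" "f k (x - h) \<le> indicator B x" for k x
  proof -
    show "f k x \<le> indicator B x" using f01[of k x] f0[of x k] by (cases "x \<in> B") (auto simp: V_def)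
    show "f k (x - h) \<le> indicator B x" using f01[of k "x - h"] f0[of "x - h" k] by (cases "x \<in> B") (auto simp: V_def)
  qed
  have 1: "(\<lambda>k. LINT x:E|lebesgue. f k x) \<longlonglongrightarrow> measure lebesgue (E \<inter> K)"
    by (rule set_integral_tendsto_indicator[OF E(1) B(3) Km(3,1) cf _ lim]) (use f01 fB in simp)
  have 2: "(\<lambda>k. LINT x:E|lebesgue. f k (x + - h)) \<longlonglongrightarrow> measure lebesgue (E \<inter> (\<lambda>x. x + h) ` K)"
  proof (rule set_integral_tendsto_indicator[OF E(1) B(3) Km(3,2)])
    show "continuous_on UNIV (\<lambda>x. f k (x + - h))" for k
      by (rule continuous_on_compose2[OF cf]) (intro continuous_intros subset_UNIV)+
    show "\<bar>f k (x + - h)\<bar> \<le> indicator B x" for k x using f01(1)[of k "x - h"] fB(2)[of k x] by simp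
    have "indicator ((\<lambda>x. x + h) ` K) x = (indicator K (x + - h) :: real)" for x
    proof -
      have "x \<in> (\<lambda>x. x + h) ` K \<longleftrightarrow> x + - h \<in> K"
      proof
        assume "x + - h \<in> K"
        then show "x \<in> (\<lambda>x. x + h) ` K" by (intro image_eqI[of _ _ "x + - h"]) simp_all
      qed auto
      then show ?thesis by (simp add: indicator_def)
    qed
    then show "(\<lambda>k. f k (x + - h)) \<longlonglongrightarrow> indicator ((\<lambda>x. x + h) ` K) x" for x using lim[of "x + - h"] by simp
  qed
  have "(LINT x:E|lebesgue. f k (x + - h)) = (LINT x:E|lebesgue. f k x)" for k
  proof (rule weakly_constant_on_translate[OF E fC B(1) B(4)])
    show "closure {x. f k x \<noteq> 0} \<subseteq> B" using fV[of k] unfolding V_def by blast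
    show "x - - h \<in> B" if "x \<in> closure {x. f k x \<noteq> 0}" for x using subsetD[OF fV that] unfolding V_def by simp
  qed
  then show ?thesis using LIMSEQ_unique[OF 1] 2 by simp
qed

text \<open>Fubini's theorem in the coordinates \<open>(x, y - x)\<close>.\<close>
lemma emeasure_mult_eq_nn_integral_translates:
  fixes A C :: "'a::euclidean_space set"
  assumes A: "A \<in> sets borel" and C: "C \<in> sets borel"
  shows "emeasure lborel A * emeasure lborel C = (\<integral>\<^sup>+h. emeasure lborel (A \<inter> (\<lambda>x. x + h) -` C) \<partial>lborel)"
proof -
  have tr: "emeasure lborel C = (\<integral>\<^sup>+h. indicator C (x + h) \<partial>lborel)" for x :: 'a
  proof -
    have "emeasure lborel C = (\<integral>\<^sup>+y. indicator C y \<partial>(distr lborel borel ((+) x)))"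
      using C by (simp add: lborel_distr_plus)
    also have "\<dots> = (\<integral>\<^sup>+h. indicator C (x + h) \<partial>lborel)" by (rule nn_integral_distr) (use C in auto)
    finally show ?thesis .
  qed
  have m: "(\<lambda>(x, h). indicator A x * indicator C (x + h) :: ennreal) \<in> borel_measurable (lborel \<Otimes>\<^sub>M lborel)"
    using A C by measurable
  have "emeasure lborel A * emeasure lborel C = (\<integral>\<^sup>+x. indicator A x * emeasure lborel C \<partial>lborel)"
    using A by (simp add: nn_integral_multc)
  also have "\<dots> = (\<integral>\<^sup>+x. \<integral>\<^sup>+h. indicator A x * indicator C (x + h) \<partial>lborel \<partial>lborel)"
    by (intro nn_integral_cong, subst tr, rule nn_integral_cmult[symmetric]) (use C in measurable)
  also have "\<dots> = (\<integral>\<^sup>+h. \<integral>\<^sup>+x. indicator A x * indicator C (x + h) \<partial>lborel \<partial>lborel)"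
    by (rule lborel_pair.Fubini'[OF m, symmetric])
  also have "\<dots> = (\<integral>\<^sup>+h. emeasure lborel (A \<inter> (\<lambda>x. x + h) -` C) \<partial>lborel)"
  proof (rule nn_integral_cong)
    fix h :: 'a
    have "(\<lambda>x. x + h) -` C \<in> sets borel" using measurable_sets[of "\<lambda>x. x + h" borel borel C] C by simp
    then have "A \<inter> (\<lambda>x. x + h) -` C \<in> sets lborel" using A by simp
    then have "emeasure lborel (A \<inter> (\<lambda>x. x + h) -` C) = (\<integral>\<^sup>+x. indicator (A \<inter> (\<lambda>x. x + h) -` C) x \<partial>lborel)"
      by (rule nn_integral_indicator[symmetric])
    also have "\<dots> = (\<integral>\<^sup>+x. indicator A x * indicator C (x + h) \<partial>lborel)"
      by (intro nn_integral_cong) (simp add: indicator_def)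
    finally show "(\<integral>\<^sup>+x. indicator A x * indicator C (x + h) \<partial>lborel) = emeasure lborel (A \<inter> (\<lambda>x. x + h) -` C)" by simp
  qed
  finally show ?thesis .
qed

lemma obtain_compact_subset_nonnull:
  fixes S :: "'a::euclidean_space set"
  assumes "S \<in> sets lebesgue" "bounded S" "\<not> negligible S"
  obtains K where "compact K" "K \<subseteq> S" "emeasure lborel K \<noteq> 0"
proof -
  have S: "emeasure lebesgue S \<noteq> 0" using assms(1,3) by (auto simp: negligible_iff_null_sets null_sets_def)
  have fin: "emeasure lebesgue S < \<infinity>" using bounded_set_imp_lmeasurable[OF assms(2,1)] by (auto simp: fmeasurable_def)
  have mpos: "measure lebesgue S > 0" using S fin by (simp add: measure_def enn2real_positive_iff zero_less_iff_neq_zero top.not_eq_extremum)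
  obtain T where T: "closed T" "T \<subseteq> S" "emeasure lebesgue (S - T) < ennreal (measure lebesgue S)"
    using sets_lebesgue_inner_closed[OF assms(1) mpos] by metis
  have cT: "compact T" using T(1) bounded_subset[OF assms(2) T(2)] compact_eq_bounded_closed by blast
  have "emeasure lborel T \<noteq> 0"
  proof
    assume 0: "emeasure lborel T = 0"
    have "emeasure lebesgue S \<le> emeasure lebesgue (S - T) + emeasure lebesgue T"
      using emeasure_subadditive[of "S - T" lebesgue T] assms(1) T(1,2) by (simp add: Un_absorb2)
    also have "\<dots> = emeasure lebesgue (S - T)" using 0 T(1) by simp
    also have "\<dots> < ennreal (measure lebesgue S)" by (rule T(3))
    also have "\<dots> = emeasure lebesgue S" using fin by (simp add: emeasure_eq_ennreal_measure)
    finally show False by simp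
  qed
  then show ?thesis using that[OF cT T(2)] by blast
qed

text \<open>Suppose that \<open>A \<subseteq> E \<inter> B\<close> and \<open>C \<subseteq> B - E\<close> are compact of positive measure. For each \<open>h\<close>, the part
of \<open>A\<close> that is carried into \<open>C\<close> by the translation \<open>h\<close> lies in \<open>E\<close> and its translate is disjoint from \<open>E\<close>,
so by translation invariance it is a null set. Integration over \<open>h\<close> gives \<open>|A||C| = 0\<close>.\<close>
lemma weakly_constant_on_ball:
  fixes E :: "'a::euclidean_space set"
  assumes E: "E \<in> sets lebesgue" "weakly_constant_on \<Omega> E"
    and B: "convex B" "open B" "bounded B" "B \<subseteq> \<Omega>"
  shows "negligible (E \<inter> B) \<or> negligible (B - E)"
proof (rule ccontr)
  assume neg: "\<not> ?thesis"
  have Bm: "B \<in> sets lebesgue" using B(2) by simp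
  have nn: "\<not> negligible (E \<inter> B)" "\<not> negligible (B - E)" using neg by blast+
  have EBm: "E \<inter> B \<in> sets lebesgue" "B - E \<in> sets lebesgue"
    by (rule sets.Int[OF E(1) Bm], rule sets.Diff[OF Bm E(1)])
  have EBb: "bounded (E \<inter> B)" "bounded (B - E)" by (rule bounded_subset[OF B(3)], blast)+
  obtain A where A: "compact A" "A \<subseteq> E \<inter> B" "emeasure lborel A \<noteq> 0"
    by (rule obtain_compact_subset_nonnull[OF EBm(1) EBb(1) nn(1)])
  obtain C where C: "compact C" "C \<subseteq> B - E" "emeasure lborel C \<noteq> 0"
    by (rule obtain_compact_subset_nonnull[OF EBm(2) EBb(2) nn(2)])
  have "emeasure lborel (A \<inter> (\<lambda>x. x + h) -` C) = 0" for h
  proof -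
    define K where "K = A \<inter> (\<lambda>x. x + h) -` C"
    have "closed ((\<lambda>x. x + h) -` C)"
      by (intro closed_vimage compact_imp_closed[OF C(1)] continuous_intros)
    then have K: "compact K" unfolding K_def using A(1) by (rule compact_Int_closed[rotated])
    have "measure lebesgue (E \<inter> K) = measure lebesgue (E \<inter> (\<lambda>x. x + h) ` K)"
    proof (rule weakly_constant_on_measure_translate[OF E B K])
      show "K \<subseteq> B" using A(2) unfolding K_def by blast
      show "x + h \<in> B" if "x \<in> K" for x using that C(2) unfolding K_def by blast
    qed
    moreover have "E \<inter> K = K" using A(2) unfolding K_def by blast
    moreover have "E \<inter> (\<lambda>x. x + h) ` K = {}" using C(2) unfolding K_def by blast
    ultimately have "measure lebesgue K = 0" by simp
    moreover have "emeasure lborel K < \<infinity>" by (rule emeasure_compact_finite[OF K])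
    moreover have "K \<in> sets borel" by (rule borel_compact[OF K])
    ultimately have "emeasure lborel K = 0"
      using emeasure_eq_ennreal_measure[of lborel K] by simp
    then show ?thesis by (simp only: K_def)
  qed
  then have "emeasure lborel A * emeasure lborel C = 0"
    using emeasure_mult_eq_nn_integral_translates[OF borel_compact[OF A(1)] borel_compact[OF C(1)]] by simp
  then show False using A(3) C(3) by simp
qed

text \<open>The balls in which \<open>E\<close> is null and those in which the complement of \<open>E\<close> is null form two open
sets that cover \<open>\<Omega>\<close>. They are disjoint in \<open>\<Omega>\<close>, because the intersection of two balls of different
kinds would be open and null.\<close>
lemma weakly_constant_on_connected:
  fixes E :: "'a::euclidean_space set"
  assumes E: "E \<in> sets lebesgue" "weakly_constant_on \<Omega> E" and \<Omega>: "open \<Omega>" "connected \<Omega>"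
  shows "negligible (\<Omega> \<inter> E) \<or> negligible (\<Omega> - E)"
proof -
  \<comment> \<open>The points of \<open>\<Omega>\<close> at which \<open>F\<close> is locally null.\<close>
  define Z where "Z F = \<Union> {ball x r | x r. ball x r \<subseteq> \<Omega> \<and> negligible (ball x r \<inter> F)}" for F
  have oZ: "open (Z F)" for F unfolding Z_def by (intro open_Union) auto
  have ZI: "x \<in> Z F" if "ball y r \<subseteq> \<Omega>" "negligible (ball y r \<inter> F)" "x \<in> ball y r" for x y r F
    using that unfolding Z_def by blast
  have ZD: "\<exists>y r. x \<in> ball y r \<and> ball y r \<subseteq> \<Omega> \<and> negligible (ball y r \<inter> F)" if "x \<in> Z F" for x F
    using that unfolding Z_def by blast
  have glob: "negligible (\<Omega> \<inter> F)" if "\<Omega> \<subseteq> Z F" for F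
    unfolding locally_negligible_alt[of "\<Omega> \<inter> F"]
  proof
    fix x assume x: "x \<in> \<Omega> \<inter> F"
    then obtain y r where "x \<in> ball y r" "negligible (ball y r \<inter> F)" using ZD[of x F] \<open>\<Omega> \<subseteq> Z F\<close> by blast
    then have "openin (top_of_set (\<Omega> \<inter> F)) ((\<Omega> \<inter> F) \<inter> ball y r) \<and> x \<in> (\<Omega> \<inter> F) \<inter> ball y r \<and> negligible ((\<Omega> \<inter> F) \<inter> ball y r)"
      using x by (auto intro: negligible_subset openin_open_Int)
    then show "\<exists>U. openin (top_of_set (\<Omega> \<inter> F)) U \<and> x \<in> U \<and> negligible U" by blast
  qed
  have cover: "\<Omega> \<subseteq> Z E \<union> Z (- E)"
  proof
    fix x assume "x \<in> \<Omega>"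
    then obtain r where r: "r > 0" "ball x r \<subseteq> \<Omega>" using \<Omega>(1) open_contains_ball by blast
    have "negligible (E \<inter> ball x r) \<or> negligible (ball x r - E)"
      by (rule weakly_constant_on_ball[OF E convex_ball open_ball bounded_ball r(2)])
    then show "x \<in> Z E \<union> Z (- E)"
      using ZI[OF r(2), of E x] ZI[OF r(2), of "- E" x] r(1) by (auto simp: Int_commute Diff_eq)
  qed
  have disj: "Z E \<inter> Z (- E) \<inter> \<Omega> = {}"
  proof (rule ccontr)
    assume "\<not> ?thesis"
    then obtain x where "x \<in> Z E" "x \<in> Z (- E)" by blast
    then obtain y r y' r' where 1: "x \<in> ball y r" "negligible (ball y r \<inter> E)"
      and 2: "x \<in> ball y' r'" "negligible (ball y' r' \<inter> - E)" using ZD by meson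
    have "negligible ((ball y r \<inter> E) \<union> (ball y' r' \<inter> - E))" by (rule negligible_Un[OF 1(2) 2(2)])
    then have "negligible (ball y r \<inter> ball y' r')" by (rule negligible_subset) auto
    moreover have "open (ball y r \<inter> ball y' r')" by auto
    ultimately show False using open_not_negligible 1(1) 2(1) by blast
  qed
  have "Z E \<inter> \<Omega> = {} \<or> Z (- E) \<inter> \<Omega> = {}" using connectedD[OF \<Omega>(2) oZ oZ disj cover] by blast
  then have "\<Omega> \<subseteq> Z (- E) \<or> \<Omega> \<subseteq> Z E" using cover by blast
  then show ?thesis using glob[of E] glob[of "- E"] by (auto simp: Diff_eq)
qed

section \<open>The solution near the boundary\<close>

text \<open>Move from \<open>x\<close> by \<open>s\<tau>\<close> and correct by a multiple of the normal \<open>\<nu>\<close>. At \<open>x + s(\<tau> \<plusminus> \<epsilon>\<nu>)\<close> the function \<open>\<rho>\<close> has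
opposite signs for small \<open>s\<close>, so a correction \<open>t\<close> with \<open>|t| \<le> \<epsilon>\<close> leads to a zero of \<open>\<rho>\<close>, hence of \<open>f\<close>. Thus
\<open>f'(\<tau> + t\<nu>)\<close> is of the order of the error of linearization, and \<open>f' \<tau>\<close> is arbitrarily small.\<close>
lemma derivative_vanishes_on_tangent:
  fixes f \<rho> :: "'a::euclidean_space \<Rightarrow> real"
  assumes T: "open T" "x \<in> T" and \<rho>: "continuous_on T \<rho>" "\<rho> x = 0" "GDERIV \<rho> x :> g" "g \<noteq> 0"
    and f: "(f has_derivative f') (at x)" "f x = 0" and zero: "\<And>y. y \<in> T \<Longrightarrow> \<rho> y = 0 \<Longrightarrow> f y = 0"
    and \<tau>: "\<tau> \<bullet> g = 0"
  shows "f' \<tau> = 0"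
proof (rule ccontr)
  assume "f' \<tau> \<noteq> 0"
  define q where "q = \<bar>f' \<tau>\<bar>"
  have q: "q > 0" using \<open>f' \<tau> \<noteq> 0\<close> by (simp add: q_def)
  define n where "n = norm g"
  have n: "n > 0" using \<rho>(4) by (simp add: n_def)
  define \<nu> where "\<nu> = g /\<^sub>R n"
  have \<nu>: "norm \<nu> = 1" "\<nu> \<bullet> g = n" using n by (simp_all add: \<nu>_def n_def power2_norm_eq_inner[symmetric] power2_eq_square field_simps)
  define p where "p = \<bar>f' \<nu>\<bar>"
  have p: "p \<ge> 0" by (simp add: p_def)
  interpret f': linear f' by (rule has_derivative_linear[OF f(1)])
  \<comment> \<open>The correction by the normal costs at most \<open>\<epsilon>p \<le> q/4\<close>.\<close>
  define \<epsilon> where "\<epsilon> = min 1 (q / (4 * (p + 1)))"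
  have \<epsilon>: "\<epsilon> > 0" "\<epsilon> \<le> 1" using p q by (simp_all add: \<epsilon>_def)
  have "\<epsilon> * (p + 1) \<le> q / (4 * (p + 1)) * (p + 1)" using p by (intro mult_right_mono) (simp_all add: \<epsilon>_def)
  also have "\<dots> = q / 4"
  proof -
    have "p + 1 \<noteq> 0" using p by simp
    then show ?thesis by (simp add: divide_simps)
  qed
  finally have \<epsilon>p: "\<epsilon> * p \<le> q / 4" using \<epsilon>(1) by (simp add: algebra_simps)
  define L where "L = norm \<tau> + 1"
  have L: "L > 0" by (simp add: L_def add_nonneg_pos)
  \<comment> \<open>The linearization error \<open>\<eta>sL\<close> must be smaller than both the change \<open>\<epsilon>sn\<close> of \<open>\<rho>\<close> and \<open>sq/4\<close>.\<close>
  define \<eta> where "\<eta> = min (\<epsilon> * n) (q / 4) / (2 * L)"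
  have \<eta>0: "\<eta> > 0" using \<epsilon> n q L by (simp add: \<eta>_def)
  have "\<eta> * L = min (\<epsilon> * n) (q / 4) / 2" using L by (simp add: \<eta>_def)
  moreover have "min (\<epsilon> * n) (q / 4) > 0" using \<epsilon> n q by simp
  ultimately have \<eta>L: "\<eta> * L < \<epsilon> * n" "\<eta> * L < q / 4" by auto
  have d\<rho>: "(\<rho> has_derivative (\<lambda>y. y \<bullet> g)) (at x)" using \<rho>(3) by (simp add: gderiv_def)
  obtain d1 where d1: "d1 > 0" "\<And>y. norm (y - x) < d1 \<Longrightarrow> norm (\<rho> y - \<rho> x - (y - x) \<bullet> g) \<le> \<eta> * norm (y - x)"
    using d\<rho>[unfolded has_derivative_at_alt] \<eta>0 by blast
  obtain d2 where d2: "d2 > 0" "\<And>y. norm (y - x) < d2 \<Longrightarrow> norm (f y - f x - f' (y - x)) \<le> \<eta> * norm (y - x)"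
    using f(1)[unfolded has_derivative_at_alt] \<eta>0 by blast
  obtain d3 where d3: "d3 > 0" "ball x d3 \<subseteq> T" using T open_contains_ball by blast
  define s where "s = min d1 (min d2 d3) / (2 * L)"
  have s: "s > 0" using d1 d2 d3 L by (simp add: s_def)
  have sL: "s * L < d1" "s * L < d2" "s * L < d3"
  proof -
    have "s * L = min d1 (min d2 d3) / 2" using L by (simp add: s_def)
    then show "s * L < d1" "s * L < d2" "s * L < d3" using d1 d2 d3 by auto
  qed
  define z where "z t = s *\<^sub>R (\<tau> + t *\<^sub>R \<nu>)" for t
  have nz: "norm (z t) \<le> s * L" if "\<bar>t\<bar> \<le> \<epsilon>" for t
  proof -
    have "norm (\<tau> + t *\<^sub>R \<nu>) \<le> norm \<tau> + \<bar>t\<bar>" using norm_triangle_ineq[of \<tau> "t *\<^sub>R \<nu>"] \<nu>(1) by simp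
    then have "norm (\<tau> + t *\<^sub>R \<nu>) \<le> L" using that \<epsilon>(2) by (simp add: L_def)
    then show ?thesis using s by (simp add: z_def)
  qed
  have zg: "z t \<bullet> g = s * t * n" for t using \<tau> \<nu>(2) by (simp add: z_def inner_add_left)
  have err: "\<eta> * norm (z t) < s * (\<epsilon> * n)" "\<eta> * norm (z t) < s * (q / 4)" if "\<bar>t\<bar> \<le> \<epsilon>" for t
  proof -
    have "\<eta> * norm (z t) \<le> \<eta> * (s * L)" using nz[OF that] \<eta>0 by (intro mult_left_mono) auto
    also have "\<dots> = s * (\<eta> * L)" by simp
    finally have le: "\<eta> * norm (z t) \<le> s * (\<eta> * L)" .
    show "\<eta> * norm (z t) < s * (\<epsilon> * n)" using le mult_strict_left_mono[OF \<eta>L(1) s] by linarith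
    show "\<eta> * norm (z t) < s * (q / 4)" using le mult_strict_left_mono[OF \<eta>L(2) s] by linarith
  qed
  have \<rho>z: "\<bar>\<rho> (x + z t) - s * t * n\<bar> \<le> \<eta> * norm (z t)" if "\<bar>t\<bar> \<le> \<epsilon>" for t
    using d1(2)[of "x + z t"] nz[OF that] sL(1) \<rho>(2) zg by simp
  have "\<exists>t\<ge>-\<epsilon>. t \<le> \<epsilon> \<and> \<rho> (x + z t) = 0"
  proof (rule IVT')
    show "\<rho> (x + z (- \<epsilon>)) \<le> 0" using \<rho>z[of "-\<epsilon>"] err(1)[of "-\<epsilon>"] \<epsilon>(1) by (simp add: mult.assoc)
    show "0 \<le> \<rho> (x + z \<epsilon>)" using \<rho>z[of \<epsilon>] err(1)[of \<epsilon>] \<epsilon>(1) by (simp add: mult.assoc)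
    show "- \<epsilon> \<le> \<epsilon>" using \<epsilon> by simp
    show "continuous_on {- \<epsilon>..\<epsilon>} (\<lambda>t. \<rho> (x + z t))"
    proof (rule continuous_on_compose2[OF \<rho>(1)])
      show "continuous_on {- \<epsilon>..\<epsilon>} (\<lambda>t. x + z t)" unfolding z_def by (intro continuous_intros)
      show "(\<lambda>t. x + z t) ` {- \<epsilon>..\<epsilon>} \<subseteq> T"
      proof (rule image_subsetI)
        fix t assume "t \<in> {- \<epsilon>..\<epsilon>}"
        then have "\<bar>t\<bar> \<le> \<epsilon>" by (simp add: abs_le_iff)
        then have "norm (z t) < d3" using nz[of t] sL(3) by linarith
        then have "x + z t \<in> ball x d3" by (simp add: dist_norm)
        then show "x + z t \<in> T" using d3(2) by blast
      qed
    qed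
  qed
  then obtain t where "- \<epsilon> \<le> t" "t \<le> \<epsilon>" and \<rho>t: "\<rho> (x + z t) = 0" by blast
  then have t: "\<bar>t\<bar> \<le> \<epsilon>" "\<rho> (x + z t) = 0" by (simp_all add: abs_le_iff)
  have "norm (z t) < d3" using nz[OF t(1)] sL(3) by linarith
  then have "x + z t \<in> ball x d3" by (simp add: dist_norm)
  then have "f (x + z t) = 0" using zero t(2) d3(2) by blast
  then have "\<bar>f' (z t)\<bar> \<le> \<eta> * norm (z t)" using d2(2)[of "x + z t"] nz[OF t(1)] sL(2) f(2) by simp
  then have "\<bar>f' (z t)\<bar> < s * (q / 4)" using err(2)[OF t(1)] by linarith
  moreover have "f' (z t) = s * (f' \<tau> + t * f' \<nu>)" by (simp add: z_def f'.scaleR f'.add)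
  ultimately have "s * \<bar>f' \<tau> + t * f' \<nu>\<bar> < s * (q / 4)" using s by (simp add: abs_mult)
  then have "\<bar>f' \<tau> + t * f' \<nu>\<bar> < q / 4" using s by (simp only: mult_less_cancel_left_pos)
  moreover have "\<bar>t * f' \<nu>\<bar> \<le> \<epsilon> * p" unfolding abs_mult p_def by (intro mult_right_mono t(1)) simp
  ultimately show False using \<epsilon>p q unfolding q_def by linarith
qed

text \<open>From a point of \<open>\<Omega>\<close> near \<open>x\<close>, going in the direction \<open>-\<nu>\<close> reaches the boundary, where \<open>f = k\<close>, after a
short way by the intermediate value theorem for \<open>\<rho>\<close>; along this way the derivative of \<open>f\<close> in the
direction \<open>\<nu>\<close> is positive.\<close>
lemma positive_inside_near_boundary:
  fixes f \<rho> :: "'a::euclidean_space \<Rightarrow> real"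
  assumes chart: "boundary_chart \<Omega> x W \<rho>" and x: "x \<in> frontier \<Omega>"
    and T: "open T" "x \<in> T" and f: "C1_on T f" and zero: "\<And>y. y \<in> T \<Longrightarrow> y \<in> frontier \<Omega> \<Longrightarrow> f y = k"
    and \<nu>: "GDERIV \<rho> x :> g" "\<nu> = g /\<^sub>R norm g" "g \<noteq> 0" and pos: "fd f x \<nu> > 0"
  obtains V where "open V" "x \<in> V" "V \<subseteq> T" "\<And>y. y \<in> V \<Longrightarrow> y \<in> \<Omega> \<Longrightarrow> f y > k"
proof -
  have W: "open W" "x \<in> W" and \<rho>s: "smooth_on W \<rho>" and OW: "\<Omega> \<inter> W = {y \<in> W. \<rho> y > 0}"
    and FW: "frontier \<Omega> \<inter> W = {y \<in> W. \<rho> y = 0}"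
    using chart unfolding boundary_chart_def by blast+
  have \<rho>c: "continuous_on W \<rho>" by (rule C1_on_continuous[OF smooth_on_imp_C1_on[OF \<rho>s]])
  have \<rho>x: "\<rho> x = 0" using FW x W(2) by blast
  define D where "D = W \<inter> (T \<inter> (\<lambda>y. fd f y \<nu>) -` {0<..})"
  have "open D" unfolding D_def
    by (intro open_Int W(1) continuous_open_preimage C1_on_continuous_fd[OF f] T(1) open_greaterThan)
  moreover have "x \<in> D" using W(2) T(2) pos by (simp add: D_def)
  ultimately obtain d where d: "d > 0" "ball x d \<subseteq> D" using open_contains_ball by blast
  have \<nu>1: "norm \<nu> = 1" using \<nu>(2,3) by simp
  have "(\<rho> has_derivative (\<lambda>y. y \<bullet> g)) (at (x + 0 *\<^sub>R (- \<nu>)))" using \<nu>(1) by (simp add: gderiv_def)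
  from has_derivative_along_line[OF this]
  have dl: "((\<lambda>s. \<rho> (x + s *\<^sub>R (- \<nu>))) has_real_derivative (- \<nu>) \<bullet> g) (at 0)" .
  have "(- \<nu>) \<bullet> g < 0" using \<nu>(2,3) by (simp add: power2_norm_eq_inner[symmetric] power2_eq_square)
  from DERIV_neg_dec_right[OF dl this] obtain e where e: "e > 0"
    "\<And>h. 0 < h \<Longrightarrow> h < e \<Longrightarrow> \<rho> (x + 0 *\<^sub>R (- \<nu>)) > \<rho> (x + (0 + h) *\<^sub>R (- \<nu>))" by blast
  define r where "r = min e d / 2"
  have r: "r > 0" "r < e" "r \<le> d / 2" using e(1) d(1) by (auto simp: r_def)
  have \<rho>r: "\<rho> (x - r *\<^sub>R \<nu>) < 0" using e(2)[OF r(1,2)] \<rho>x by simp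
  define V where "V = ball x (d / 2) \<inter> (\<lambda>y. y - r *\<^sub>R \<nu>) -` (W \<inter> \<rho> -` {..<0})"
  have "open (W \<inter> \<rho> -` {..<0})" by (intro continuous_open_preimage \<rho>c W(1) open_lessThan)
  then have "open V" unfolding V_def
    by (intro open_Int[OF open_ball] open_vimage[of "W \<inter> \<rho> -` {..<0}"] continuous_intros)
  have inD: "y - t *\<^sub>R \<nu> \<in> D" if "y \<in> ball x (d / 2)" "0 \<le> t" "t \<le> r" for y t
  proof -
    have "dist x (y - t *\<^sub>R \<nu>) \<le> dist x y + dist y (y - t *\<^sub>R \<nu>)" by (rule dist_triangle)
    also have "dist y (y - t *\<^sub>R \<nu>) = t" using that(2) \<nu>1 by (simp add: dist_norm)
    also have "dist x y + t < d" using that r(3) by simp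
    finally show ?thesis using d(2) by (auto simp: subset_iff)
  qed
  show ?thesis
  proof (rule that[OF \<open>open V\<close>])
    have "x - r *\<^sub>R \<nu> \<in> D" using inD[of x r] d(1) r(1) by simp
    then show "x \<in> V" unfolding V_def using d(1) \<rho>r by (simp add: D_def)
    have "y \<in> D" if "y \<in> V" for y using inD[of y 0] that r(1) by (simp add: V_def)
    then show "V \<subseteq> T" unfolding D_def by blast
    fix y assume y: "y \<in> V" "y \<in> \<Omega>"
    have yb: "y \<in> ball x (d / 2)" using y(1) by (simp add: V_def)
    have "y \<in> W" using inD[OF yb, of 0] r(1) by (simp add: D_def)
    then have \<rho>y: "\<rho> y > 0" using OW y(2) by blast
    have "\<exists>t\<ge>0. t \<le> r \<and> - \<rho> (y - t *\<^sub>R \<nu>) = 0"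
    proof (rule IVT')
      show "- \<rho> (y - 0 *\<^sub>R \<nu>) \<le> 0" using \<rho>y by simp
      show "0 \<le> - \<rho> (y - r *\<^sub>R \<nu>)" using y(1) by (simp add: V_def)
      show "0 \<le> r" using r(1) by simp
      show "continuous_on {0..r} (\<lambda>t. - \<rho> (y - t *\<^sub>R \<nu>))"
      proof (rule continuous_on_minus, rule continuous_on_compose2[OF \<rho>c])
        show "continuous_on {0..r} (\<lambda>t. y - t *\<^sub>R \<nu>)" by (intro continuous_intros)
        show "(\<lambda>t. y - t *\<^sub>R \<nu>) ` {0..r} \<subseteq> W" using inD[OF yb] unfolding D_def by auto
      qed
    qed
    then obtain t where t: "0 \<le> t" "t \<le> r" "\<rho> (y - t *\<^sub>R \<nu>) = 0" by auto
    define b where "b = y - t *\<^sub>R \<nu>"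
    have "b \<in> D" unfolding b_def by (rule inD[OF yb t(1,2)])
    then have bW: "b \<in> W" "b \<in> T" by (auto simp: D_def)
    then have fb: "f b = k" using zero FW t(3) by (auto simp: b_def)
    have t0: "t > 0" using t \<rho>y by (cases "t = 0") auto
    have line: "b + s *\<^sub>R \<nu> \<in> D" if "0 \<le> s" "s \<le> t" for s
    proof -
      have "b + s *\<^sub>R \<nu> = y - (t - s) *\<^sub>R \<nu>" by (simp add: b_def algebra_simps)
      then show ?thesis using inD[OF yb, of "t - s"] that t(2) by simp
    qed
    have "((\<lambda>s. f (b + s *\<^sub>R \<nu>)) has_real_derivative fd f (b + s *\<^sub>R \<nu>) \<nu>) (at s)" if "0 \<le> s" "s \<le> t" for s
      by (rule has_derivative_along_line[OF C1_on_has_derivative[OF f]]) (use line[OF that] D_def in blast)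
    from MVT2[OF t0 this] obtain \<xi> where \<xi>: "0 < \<xi>" "\<xi> < t"
      "f (b + t *\<^sub>R \<nu>) - f (b + 0 *\<^sub>R \<nu>) = (t - 0) * fd f (b + \<xi> *\<^sub>R \<nu>) \<nu>" by blast
    have "fd f (b + \<xi> *\<^sub>R \<nu>) \<nu> > 0" using line[of \<xi>] \<xi>(1,2) by (simp add: D_def)
    then have "f (b + t *\<^sub>R \<nu>) > f b" using \<xi>(3) t0 by (metis add_cancel_right_right diff_gt_0_iff_gt diff_zero mult_pos_pos scale_zero_left)
    then show "f y > k" using fb by (simp add: b_def)
  qed
qed

section \<open>Minimizers of the Cheeger problem\<close>

text \<open>Passes from the one-sided derivative of \<open>u\<close>, known on the closure of \<open>\<Omega>\<close> only, to the derivative of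
its smooth extension \<open>v\<close>: for small \<open>t > 0\<close> the point \<open>x + t\<nu>\<close> lies in \<open>\<Omega>\<close>.\<close>
lemma fd_inner_normal_eq:
  fixes u v :: "'a::euclidean_space \<Rightarrow> real"
  assumes chart: "boundary_chart \<Omega> x W \<rho>" and x: "x \<in> frontier \<Omega>"
    and g: "GDERIV \<rho> x :> g" "\<nu> = g /\<^sub>R norm g" "g \<noteq> 0"
    and v: "(v has_derivative fd v x) (at x)" and uv: "\<And>y. y \<in> closure \<Omega> \<Longrightarrow> u y = v y"
    and u: "has_directional_derivative u x \<nu> c"
  shows "fd v x \<nu> = c"
proof -
  have W: "open W" "x \<in> W" and OW: "\<Omega> \<inter> W = {y \<in> W. \<rho> y > 0}"
    and FW: "frontier \<Omega> \<inter> W = {y \<in> W. \<rho> y = 0}"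
    using chart unfolding boundary_chart_def by blast+
  have \<rho>x: "\<rho> x = 0" using FW x W(2) by blast
  have "(\<rho> has_derivative (\<lambda>y. y \<bullet> g)) (at (x + 0 *\<^sub>R \<nu>))" using g(1) by (simp add: gderiv_def)
  from has_derivative_along_line[OF this]
  have dl: "((\<lambda>s. \<rho> (x + s *\<^sub>R \<nu>)) has_real_derivative \<nu> \<bullet> g) (at 0)" .
  have "\<nu> \<bullet> g > 0" using g(2,3) by (simp add: power2_norm_eq_inner[symmetric] power2_eq_square)
  from DERIV_pos_inc_right[OF dl this] obtain e where e: "e > 0"
    "\<And>h. 0 < h \<Longrightarrow> h < e \<Longrightarrow> \<rho> (x + 0 *\<^sub>R \<nu>) < \<rho> (x + (0 + h) *\<^sub>R \<nu>)" by blast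
  have "open ((\<lambda>t. x + t *\<^sub>R \<nu>) -` W)" by (intro open_vimage W(1) continuous_intros)
  moreover have "0 \<in> (\<lambda>t. x + t *\<^sub>R \<nu>) -` W" using W(2) by simp
  ultimately obtain d where d: "d > 0" "ball 0 d \<subseteq> (\<lambda>t. x + t *\<^sub>R \<nu>) -` W"
    using open_contains_ball by blast
  have ev: "\<forall>\<^sub>F t in at_right 0. u (x + t *\<^sub>R \<nu>) = v (x + t *\<^sub>R \<nu>)"
    unfolding eventually_at_right_field
  proof (intro exI conjI allI impI)
    show "0 < min e d" using e(1) d(1) by simp
    fix t assume t: "0 < t" "t < min e d"
    have "t \<in> ball 0 d" using t by (simp add: dist_real_def)
    then have "x + t *\<^sub>R \<nu> \<in> W" using d(2) by blast
    moreover have "\<rho> (x + t *\<^sub>R \<nu>) > 0" using e(2)[of t] t \<rho>x by simp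
    ultimately have "x + t *\<^sub>R \<nu> \<in> \<Omega>" using OW by blast
    then show "u (x + t *\<^sub>R \<nu>) = v (x + t *\<^sub>R \<nu>)" using uv closure_subset[of \<Omega>] by blast
  qed
  have ux: "u x = v x" using uv x by (simp add: frontier_def)
  have "((\<lambda>t. (u (x + t *\<^sub>R \<nu>) - u (x + 0 *\<^sub>R \<nu>)) / (t - 0)) \<longlongrightarrow> c) (at_right 0)"
    using u unfolding has_directional_derivative_def has_field_derivative_iff .
  then have "((\<lambda>t. (v (x + t *\<^sub>R \<nu>) - v (x + 0 *\<^sub>R \<nu>)) / (t - 0)) \<longlongrightarrow> c) (at_right 0)"
    by (rule Lim_transform_eventually) (use ev in \<open>rule eventually_mono, simp add: ux\<close>)
  moreover have "((\<lambda>t. v (x + t *\<^sub>R \<nu>)) has_real_derivative fd v x \<nu>) (at 0)"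
    by (rule has_derivative_along_line) (use v in simp)
  then have "((\<lambda>t. (v (x + t *\<^sub>R \<nu>) - v (x + 0 *\<^sub>R \<nu>)) / (t - 0)) \<longlongrightarrow> fd v x \<nu>) (at_right 0)"
    unfolding has_field_derivative_iff by (rule filterlim_at_split[THEN iffD1, THEN conjunct2])
  ultimately show ?thesis using tendsto_unique[OF trivial_limit_at_right_real] by blast
qed

lemma grad_eq_scaleR_normal:
  fixes f \<rho> :: "'a::euclidean_space \<Rightarrow> real"
  assumes chart: "boundary_chart \<Omega> x W \<rho>" and x: "x \<in> frontier \<Omega>"
    and T: "open T" "x \<in> T" and f: "C1_on T f" and zero: "\<And>y. y \<in> T \<Longrightarrow> y \<in> frontier \<Omega> \<Longrightarrow> f y = 0"
    and g: "GDERIV \<rho> x :> g" "\<nu> = g /\<^sub>R norm g" "g \<noteq> 0" and c: "fd f x \<nu> = c"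
  shows "grad f x = c *\<^sub>R \<nu>"
proof -
  have W: "open W" "x \<in> W" and \<rho>s: "smooth_on W \<rho>"
    and FW: "frontier \<Omega> \<inter> W = {y \<in> W. \<rho> y = 0}"
    using chart unfolding boundary_chart_def by blast+
  have \<rho>c: "continuous_on (W \<inter> T) \<rho>"
    using continuous_on_subset[OF C1_on_continuous[OF smooth_on_imp_C1_on[OF \<rho>s]]] by blast
  have \<rho>x: "\<rho> x = 0" using FW x W(2) by blast
  have \<nu>1: "norm \<nu> = 1" using g(2,3) by simp
  have g\<nu>: "g = norm g *\<^sub>R \<nu>" using g(2,3) by simp
  have tan: "fd f x \<tau> = 0" if "\<tau> \<bullet> \<nu> = 0" for \<tau>
  proof (rule derivative_vanishes_on_tangent[OF _ _ \<rho>c \<rho>x g(1,3) C1_on_has_derivative[OF f T(2)]])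
    show "open (W \<inter> T)" "x \<in> W \<inter> T" using W T by auto
    show "f x = 0" by (rule zero[OF T(2) x])
    show "f y = 0" if "y \<in> W \<inter> T" "\<rho> y = 0" for y using that FW zero by blast
    show "\<tau> \<bullet> g = 0" using that by (subst g\<nu>) simp
  qed
  interpret l: linear "fd f x" by (rule C1_on_linear[OF f T(2)])
  have "grad f x \<bullet> y = (c *\<^sub>R \<nu>) \<bullet> y" for y
  proof -
    have "(y - (y \<bullet> \<nu>) *\<^sub>R \<nu>) \<bullet> \<nu> = 0" using \<nu>1 by (simp add: inner_diff_left norm_eq_1)
    then have "fd f x (y - (y \<bullet> \<nu>) *\<^sub>R \<nu>) = 0" by (rule tan)
    then have "fd f x y = (y \<bullet> \<nu>) * c" by (simp add: l.diff l.scaleR c)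
    then show ?thesis using grad_inner[OF f T(2), of y] by (simp add: inner_commute mult.commute)
  qed
  then show ?thesis using vector_eq_rdot by blast
qed

lemma laplacian_cong_open:
  assumes "open S" "x \<in> S" "\<And>y. y \<in> S \<Longrightarrow> f y = g y"
  shows "laplacian f x = laplacian g x"
proof -
  have "fd (\<lambda>y. fd f y b) x = fd (\<lambda>y. fd g y b) x" for b
  proof (rule fd_cong_open[OF assms(1,2)])
    show "fd f y b = fd g y b" if "y \<in> S" for y
      by (rule fun_cong[OF fd_cong_open[OF assms(1) that assms(3)]])
  qed
  then show ?thesis unfolding laplacian_def by (simp only:)
qed

text \<open>The calibration inequality for \<open>(t\<psi> - X)/c\<close>, whose divergence is \<open>(t div \<psi> + 1)/c\<close> in \<open>\<Omega>\<close>. Taking \<open>\<psi> = 0\<close>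
gives the lower bound \<open>|E|/c\<close> for the perimeter.\<close>
lemma calibrated_perturbation_le_perimeter:
  fixes X \<psi> :: "'a::euclidean_space \<Rightarrow> 'a"
  assumes \<Omega>: "open \<Omega>" "bounded \<Omega>" "closure \<Omega> \<subseteq> U" and U: "open U" and X: "C1_on U X"
    and div: "\<And>x. x \<in> \<Omega> \<Longrightarrow> divergence X x = - 1"
    and \<psi>: "C1_compact \<psi>" and c: "c > 0" and le: "\<And>x. x \<in> closure \<Omega> \<Longrightarrow> norm (t *\<^sub>R \<psi> x - X x) \<le> c"
    and E: "E \<in> sets lebesgue" "E \<subseteq> \<Omega>"
  shows "ennreal ((measure lebesgue E + t * (LINT x:E|lebesgue. divergence \<psi> x)) / c) \<le> perimeter E"
proof -
  define Y where "Y x = (1 / c) *\<^sub>R (t *\<^sub>R \<psi> x + (- 1) *\<^sub>R X x)" for x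
  have \<psi>U: "C1_on U \<psi>" using \<psi> C1_on_subset unfolding C1_compact_def by blast
  have t\<psi>: "C1_on U (\<lambda>x. t *\<^sub>R \<psi> x)" and mX: "C1_on U (\<lambda>x. (- 1) *\<^sub>R X x)"
    by (rule C1_on_scaleR_const[OF \<psi>U], rule C1_on_scaleR_const[OF X])
  have s: "C1_on U (\<lambda>x. t *\<^sub>R \<psi> x + (- 1) *\<^sub>R X x)" by (rule C1_on_add[OF t\<psi> mX])
  have YC: "C1_on U Y" unfolding Y_def[abs_def] by (rule C1_on_scaleR_const[OF s])
  have Y1: "norm (Y x) \<le> 1" if "x \<in> closure \<Omega>" for x
    using le[OF that] c by (simp add: Y_def)
  have divY: "divergence Y x = (1 / c) * (t * divergence \<psi> x + 1)" if "x \<in> E" for x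
  proof -
    have xO: "x \<in> \<Omega>" using that E(2) by blast
    have xU: "x \<in> U" using xO \<Omega>(3) closure_subset[of \<Omega>] by blast
    have "divergence Y x = (1 / c) * (divergence (\<lambda>x. t *\<^sub>R \<psi> x) x + divergence (\<lambda>x. (- 1) *\<^sub>R X x) x)"
      unfolding Y_def[abs_def] divergence_scaleR_const[OF s xU] divergence_add[OF t\<psi> mX xU] ..
    also have "\<dots> = (1 / c) * (t * divergence \<psi> x + 1)"
      unfolding divergence_scaleR_const[OF \<psi>U xU] divergence_scaleR_const[OF X xU] div[OF xO] by simp
    finally show ?thesis .
  qed
  have Em: "E \<in> lmeasurable" using bounded_set_imp_lmeasurable[OF bounded_subset[OF \<Omega>(2) E(2)] E(1)] .
  have i1: "set_integrable lebesgue E (\<lambda>x. t * divergence \<psi> x)"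
    using set_integrable_divergence[OF \<psi> E(1)] by (intro set_integrable_mult_right)
  have iE: "integrable lebesgue (indicator E :: 'a \<Rightarrow> real)"
    by (rule integrable_real_indicator) (use Em in \<open>auto simp: fmeasurable_def\<close>)
  then have i2: "set_integrable lebesgue E (\<lambda>x. 1 :: real)" by (simp add: set_integrable_def)
  have "(LINT x:E|lebesgue. divergence Y x) = (LINT x:E|lebesgue. (1 / c) * (t * divergence \<psi> x + 1))"
    unfolding set_lebesgue_integral_def
    by (intro Bochner_Integration.integral_cong refl) (simp add: indicator_def divY)
  also have "\<dots> = (1 / c) * (LINT x:E|lebesgue. t * divergence \<psi> x + 1)" by (rule set_integral_mult_right)
  also have "(LINT x:E|lebesgue. t * divergence \<psi> x + 1) = (LINT x:E|lebesgue. t * divergence \<psi> x) + (LINT x:E|lebesgue. 1)"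
    by (rule set_integral_add(2)[OF i1 i2])
  also have "(LINT x:E|lebesgue. t * divergence \<psi> x) = t * (LINT x:E|lebesgue. divergence \<psi> x)"
    by (rule set_integral_mult_right)
  also have "(LINT x:E|lebesgue. 1) = measure lebesgue E"
    by (simp add: set_lebesgue_integral_def)
  finally have "(LINT x:E|lebesgue. divergence Y x) = (measure lebesgue E + t * (LINT x:E|lebesgue. divergence \<psi> x)) / c"
    by simp
  then show ?thesis using calibration_le_perimeter[OF \<Omega> U YC Y1 E(2)] by simp
qed

text \<open>On the compact support of \<open>\<psi>\<close> the length of \<open>X\<close> is bounded away from \<open>c\<close>, so \<open>(t\<psi> - X)/c\<close> is an
admissible calibration for all small \<open>t\<close> of either sign. Comparison with the assumed perimeter bound
leaves \<open>t\<close> times the integral of \<open>div \<psi>\<close> nonpositive for both signs.\<close>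
lemma weakly_constant_on_if_perimeter_le:
  fixes X :: "'a::euclidean_space \<Rightarrow> 'a"
  assumes \<Omega>: "open \<Omega>" "bounded \<Omega>" "closure \<Omega> \<subseteq> U" and U: "open U" and X: "C1_on U X"
    and div: "\<And>x. x \<in> \<Omega> \<Longrightarrow> divergence X x = - 1"
    and c: "c > 0" and le: "\<And>x. x \<in> closure \<Omega> \<Longrightarrow> norm (X x) \<le> c" and less: "\<And>x. x \<in> \<Omega> \<Longrightarrow> norm (X x) < c"
    and E: "E \<in> sets lebesgue" "E \<subseteq> \<Omega>" and P: "perimeter E \<le> ennreal (measure lebesgue E / c)"
  shows "weakly_constant_on \<Omega> E"
  unfolding weakly_constant_on_def
proof (intro allI impI)
  fix \<psi> :: "'a \<Rightarrow> 'a" assume \<psi>: "C1_compact \<psi>" "closure {x. \<psi> x \<noteq> 0} \<subseteq> \<Omega>"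
  define K where "K = closure {x. \<psi> x \<noteq> 0}"
  define I where "I = (LINT x:E|lebesgue. divergence \<psi> x)"
  have K: "compact K" and \<psi>C: "C1_on UNIV \<psi>" using \<psi>(1) by (simp_all add: C1_compact_def K_def)
  have \<psi>0: "\<psi> x = 0" if "x \<notin> K" for x using that closure_subset[of "{x. \<psi> x \<noteq> 0}"] unfolding K_def by blast
  have KU: "K \<subseteq> U" using \<psi>(2) \<Omega>(3) closure_subset[of \<Omega>] unfolding K_def by blast
  have "\<exists>m<c. \<forall>x\<in>K. norm (X x) \<le> m"
  proof (cases "K = {}")
    case True then show ?thesis by (intro exI[of _ "c - 1"]) simp
  next
    case False
    have "continuous_on K (\<lambda>x. norm (X x))"
      by (intro continuous_on_norm continuous_on_subset[OF C1_on_continuous[OF X] KU])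
    from continuous_attains_sup[OF K False this] obtain z where "z \<in> K" "\<forall>x\<in>K. norm (X x) \<le> norm (X z)" by blast
    then show ?thesis using less[of z] \<psi>(2) unfolding K_def by blast
  qed
  then obtain m where m: "m < c" "\<And>x. x \<in> K \<Longrightarrow> norm (X x) \<le> m" by blast
  have "compact (\<psi> ` K)"
    by (rule compact_continuous_image[OF continuous_on_subset[OF C1_on_continuous[OF \<psi>C] subset_UNIV] K])
  then obtain M where M: "M > 0" "\<And>x. x \<in> K \<Longrightarrow> norm (\<psi> x) \<le> M"
    using compact_imp_bounded[of "\<psi> ` K"] unfolding bounded_pos by blast
  \<comment> \<open>For \<open>|t| \<le> s\<close> the perturbation uses up at most the gap \<open>c - m\<close>.\<close>
  define s where "s = (c - m) / M"
  have s: "s > 0" using m(1) M(1) by (simp add: s_def)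
  have le0: "t * I \<le> 0" if t: "\<bar>t\<bar> \<le> s" for t
  proof -
    have "norm (t *\<^sub>R \<psi> x - X x) \<le> c" if x: "x \<in> closure \<Omega>" for x
    proof (cases "x \<in> K")
      case True
      have "norm (t *\<^sub>R \<psi> x - X x) \<le> \<bar>t\<bar> * norm (\<psi> x) + norm (X x)"
        using norm_triangle_ineq4[of "t *\<^sub>R \<psi> x" "X x"] by simp
      also have "\<dots> \<le> s * M + m" using t s M(2)[OF True] m(2)[OF True] by (intro add_mono mult_mono) auto
      also have "\<dots> = c" using M(1) by (simp add: s_def)
      finally show ?thesis .
    next
      case False
      then show ?thesis using \<psi>0[OF False] le[OF x] by simp
    qed
    from calibrated_perturbation_le_perimeter[OF \<Omega> U X div \<psi>(1) c this E]
    have "ennreal ((measure lebesgue E + t * I) / c) \<le> ennreal (measure lebesgue E / c)"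
      using P unfolding I_def by (rule order_trans)
    then have "(measure lebesgue E + t * I) / c \<le> measure lebesgue E / c"
      using c by (simp add: ennreal_le_iff)
    then show ?thesis using c by (simp add: divide_le_cancel)
  qed
  have "s * I \<le> 0" "- (s * I) \<le> 0" using le0[of s] le0[of "- s"] s by simp_all
  then have "s * I = 0" by linarith
  then show "(LINT x:E|lebesgue. divergence \<psi> x) = 0" using s unfolding I_def by simp
qed

theorem corollary1p2:
  fixes \<Omega>0 \<Omega>1 \<Omega> :: "(real ^ 'n) set"
    and u :: "real ^ 'n \<Rightarrow> real"
    and a c :: real
  assumes dim: "CARD('n) \<ge> 2"
    and \<Omega>0: "open \<Omega>0" "connected \<Omega>0" "bounded \<Omega>0" "\<Omega>0 \<noteq> {}"
    and \<Omega>1: "open \<Omega>1" "connected \<Omega>1" "bounded \<Omega>1" "\<Omega>1 \<noteq> {}"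
    and compactly_inside: "closure \<Omega>1 \<subseteq> \<Omega>0"
    and \<Omega>_eq: "\<Omega> = \<Omega>0 - closure \<Omega>1"
    and \<Omega>: "connected \<Omega>" "smooth_boundary \<Omega>" "\<not> standard_annulus \<Omega>"
    and pos: "a > 0" "c > 0"
    and u_smooth: "smooth_up_to_boundary \<Omega> u"
    and pde: "\<forall>x\<in>\<Omega>. - laplacian u x = 1"
    and outer: "\<forall>x\<in>frontier \<Omega>0. u x = 0"
      "\<forall>x\<in>frontier \<Omega>0. \<forall>\<nu>. inner_unit_normal \<Omega> x \<nu> \<longrightarrow> has_directional_derivative u x \<nu> c"
    and inner: "\<forall>x\<in>frontier \<Omega>1. u x = a"
      "\<forall>x\<in>frontier \<Omega>1. \<forall>\<nu>. inner_unit_normal \<Omega> x \<nu> \<longrightarrow> has_directional_derivative u x \<nu> c"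
  shows "cheeger_constant \<Omega> = perimeter \<Omega> / emeasure lebesgue \<Omega>
    \<and> perimeter \<Omega> / emeasure lebesgue \<Omega> = ennreal (1 / c)
    \<and> cheeger_minimizer \<Omega> \<Omega>
    \<and> (\<forall>E. cheeger_minimizer \<Omega> E \<longrightarrow> sym_diff E \<Omega> \<in> null_sets lebesgue)"
proof -
  have oO: "open \<Omega>" unfolding \<Omega>_eq by (intro open_Diff \<Omega>0(1) closed_closure)
  have bO: "bounded \<Omega>" unfolding \<Omega>_eq by (rule bounded_subset[OF \<Omega>0(3)]) blast
  have ne: "\<Omega> \<noteq> {}"
  proof
    assume "\<Omega> = {}"
    then have "\<Omega>0 = closure \<Omega>1" using compactly_inside unfolding \<Omega>_eq by blast
    then have "closed \<Omega>0" by simp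
    then have "\<Omega>0 = UNIV" using \<Omega>0(1,4) clopen[of \<Omega>0] by blast
    then show False using \<Omega>0(3) by simp
  qed
  have fr: "x \<in> frontier \<Omega>0 \<or> x \<in> frontier \<Omega>1" if x: "x \<in> frontier \<Omega>" for x
  proof -
    have xc: "x \<in> closure \<Omega>" and xO: "x \<notin> \<Omega>" using x oO by (simp_all add: frontier_def interior_open)
    have x0: "x \<in> closure \<Omega>0" using xc closure_mono[of \<Omega> \<Omega>0] unfolding \<Omega>_eq by blast
    have "\<Omega>1 \<inter> \<Omega> = {}" using closure_subset[of \<Omega>1] unfolding \<Omega>_eq by blast
    then have x1: "x \<notin> \<Omega>1" using open_Int_closure_eq_empty[OF \<Omega>1(1)] xc by blast
    show ?thesis using x0 x1 xO \<Omega>0(1) \<Omega>1(1) unfolding frontier_def interior_open[OF \<Omega>0(1)] interior_open[OF \<Omega>1(1)] \<Omega>_eq by blast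
  qed
  obtain U v where U: "open U" "closure \<Omega> \<subseteq> U" and v: "smooth_on U v" and uv: "\<And>x. x \<in> closure \<Omega> \<Longrightarrow> u x = v x"
    using u_smooth unfolding smooth_up_to_boundary_def by blast
  have OU: "\<Omega> \<subseteq> U" using U(2) closure_subset[of \<Omega>] by blast
  have vC: "C1_on U v" by (rule smooth_on_imp_C1_on[OF v])
  have lap: "laplacian v x = - 1" if "x \<in> \<Omega>" for x
  proof -
    have "laplacian u x = laplacian v x"
      by (rule laplacian_cong_open[OF oO that]) (use uv closure_subset[of \<Omega>] in blast)
    then show ?thesis using pde that by force
  qed
  have "frontier \<Omega>0 \<inter> frontier \<Omega>1 = {}"
    using compactly_inside unfolding frontier_def interior_open[OF \<Omega>0(1)] by blast
  then obtain S0 S1 where S: "open S0" "open S1" "frontier \<Omega>0 \<subseteq> S0" "frontier \<Omega>1 \<subseteq> S1" "S0 \<inter> S1 = {}"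
    using separation_normal[OF frontier_closed frontier_closed] by metis
  define T where "T = U \<inter> (S0 \<union> S1)"
  have oT: "open T" and TU: "T \<subseteq> U" unfolding T_def using U(1) S(1,2) by auto
  \<comment> \<open>Subtracting the boundary values, near the outer and the inner boundary separately, leaves the gradient unchanged.\<close>
  define g where "g x = (if x \<in> S0 then v x else v x - a)" for x
  have gloc: "\<exists>R k. open R \<and> x \<in> R \<and> R \<subseteq> U \<and> (\<forall>y\<in>R. v y - k = g y)" if "x \<in> T" for x
  proof (cases "x \<in> S0")
    case True
    then show ?thesis using that U(1) S(1) by (intro exI[of _ "U \<inter> S0"] exI[of _ 0]) (auto simp: T_def g_def)
  next
    case False
    then show ?thesis using that U(1) S(2,5) by (intro exI[of _ "U \<inter> S1"] exI[of _ a]) (auto simp: T_def g_def)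
  qed
  have gC: "C1_on T g"
  proof (rule C1_on_locally)
    fix x assume "x \<in> T"
    from gloc[OF this] obtain R k where R: "open R" "x \<in> R" "R \<subseteq> U" "\<forall>y\<in>R. v y - k = g y" by blast
    have "C1_on R g"
      by (rule C1_on_cong[OF R(1) C1_on_diff[OF C1_on_subset[OF vC R(3)] C1_on_const]]) (use R(4) in blast)
    then show "\<exists>R. open R \<and> x \<in> R \<and> C1_on R g" using R by blast
  qed
  have fdg: "fd g x = fd v x" if "x \<in> T" for x
  proof -
    from gloc[OF that] obtain R k where R: "open R" "x \<in> R" "R \<subseteq> U" "\<forall>y\<in>R. v y - k = g y" by blast
    have "fd g x = fd (\<lambda>y. v y - k) x" by (rule fd_cong_open[OF R(1,2)]) (use R(4) in simp)
    also have "\<dots> = fd v x"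
      using has_derivative_diff[OF C1_on_has_derivative[OF vC subsetD[OF TU that]] has_derivative_const[of k]]
      by (intro fd_eqI) simp
    finally show ?thesis .
  qed
  have frT: "x \<in> T" "g x = 0" if x: "x \<in> frontier \<Omega>" for x
  proof -
    have xU: "x \<in> U" using x U(2) unfolding frontier_def by blast
    have ux: "u x = v x" using x uv unfolding frontier_def by blast
    from fr[OF x] show "x \<in> T" using S(3,4) xU unfolding T_def by blast
    from fr[OF x] show "g x = 0"
    proof
      assume "x \<in> frontier \<Omega>0"
      then show ?thesis using outer(1) ux S(3) by (auto simp: g_def)
    next
      assume x1: "x \<in> frontier \<Omega>1"
      then have "x \<notin> S0" using S(4,5) by blast
      then show ?thesis using inner(1) ux x1 by (auto simp: g_def)
    qed
  qed
  have bdry: "norm (grad v x) = c \<and> (\<exists>V. open V \<and> x \<in> V \<and> V \<subseteq> T \<and> (\<forall>y\<in>V. y \<in> \<Omega> \<longrightarrow> g y > 0))"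
    if x: "x \<in> frontier \<Omega>" for x
  proof -
    obtain W \<rho> where ch: "boundary_chart \<Omega> x W \<rho>" using \<Omega>(2) x unfolding smooth_boundary_def by blast
    then obtain b where b: "b \<noteq> 0" "GDERIV \<rho> x :> b" unfolding boundary_chart_def by blast
    define \<nu> where "\<nu> = b /\<^sub>R norm b"
    have "inner_unit_normal \<Omega> x \<nu>" unfolding inner_unit_normal_def \<nu>_def using x ch b(2) by blast
    then have dir: "has_directional_derivative u x \<nu> c" using fr[OF x] outer(2) inner(2) by blast
    have xT: "x \<in> T" by (rule frT(1)[OF x])
    have "fd v x \<nu> = c"
      by (rule fd_inner_normal_eq[OF ch x b(2) \<nu>_def b(1) C1_on_has_derivative[OF vC subsetD[OF TU xT]] uv dir])
    then have gc: "fd g x \<nu> = c" by (simp add: fdg[OF xT])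
    have "grad g x = c *\<^sub>R \<nu>"
      by (rule grad_eq_scaleR_normal[OF ch x oT xT gC frT(2) b(2) \<nu>_def b(1) gc])
    moreover have "grad g x = grad v x" by (simp add: grad_def fdg[OF xT])
    ultimately have "norm (grad v x) = c" using b(1) pos(2) by (simp add: \<nu>_def)
    moreover have gpos: "fd g x \<nu> > 0" using gc pos(2) by simp
    have "\<exists>V. open V \<and> x \<in> V \<and> V \<subseteq> T \<and> (\<forall>y\<in>V. y \<in> \<Omega> \<longrightarrow> g y > 0)"
    proof (rule positive_inside_near_boundary[OF ch x oT xT gC _ b(2) \<nu>_def b(1) gpos])
      show "g y = 0" if "y \<in> T" "y \<in> frontier \<Omega>" for y by (rule frT(2)[OF that(2)])
    qed blast
    ultimately show ?thesis by blast
  qed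
  define X where "X = grad v"
  have XC: "C1_on U X" unfolding X_def by (rule C1_on_grad[OF v])
  have divX: "divergence X x = - 1" if "x \<in> \<Omega>" for x
    using divergence_grad[OF v subsetD[OF OU that]] lap[OF that] by (simp add: X_def)
  have Xfr: "norm (X x) = c" if "x \<in> frontier \<Omega>" for x using bdry[OF that] by (simp add: X_def)
  have Xless: "norm (X x) < c" if "x \<in> \<Omega>" for x
    unfolding X_def by (rule norm_grad_less_boundary_value[OF oO bO U(2) v lap _ _ that]) (use Xfr in \<open>simp_all add: X_def\<close>)
  have Xle: "norm (X x) \<le> c" if "x \<in> closure \<Omega>" for x
    using that Xless[of x] Xfr[of x] closure_Un_frontier[of \<Omega>] by force
  define N where "N = \<Union> {V. open V \<and> V \<subseteq> T \<and> (\<forall>y\<in>V. y \<in> \<Omega> \<longrightarrow> g y > 0)}"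
  have oN: "open N" unfolding N_def by (rule open_Union) simp
  have frN: "frontier \<Omega> \<subseteq> N"
  proof
    fix x assume x: "x \<in> frontier \<Omega>"
    from conjunct2[OF bdry[OF x]] obtain V
      where "open V" "x \<in> V" "V \<subseteq> T" "\<forall>y\<in>V. y \<in> \<Omega> \<longrightarrow> g y > 0" by (elim exE conjE)
    then show "x \<in> N" unfolding N_def by (intro UnionI[of V]) simp_all
  qed
  have NT: "N \<subseteq> T" unfolding N_def by (rule Union_least) simp
  have gN: "g x > 0" if "x \<in> N" "x \<in> \<Omega>" for x using that unfolding N_def by (elim UnionE) simp
  have fdgX: "fd g x y = X x \<bullet> y" if "x \<in> N" for x y
  proof -
    have xT: "x \<in> T" using that NT by blast
    show ?thesis unfolding X_def fdg[OF xT] by (rule grad_inner[OF vC subsetD[OF TU xT], symmetric])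
  qed
  have PO: "perimeter \<Omega> \<le> ennreal (measure lebesgue \<Omega> / c)"
    by (rule perimeter_le_calibrated[OF oO bO U(2,1) XC divX oN frN order_trans[OF NT TU]
          C1_on_subset[OF gC NT] frT(2) gN fdgX pos(2) Xfr])
  have Om: "\<Omega> \<in> sets lebesgue" using oO by simp
  have lower: "ennreal (measure lebesgue E / c) \<le> perimeter E" if E: "E \<in> sets lebesgue" "E \<subseteq> \<Omega>" for E
  proof -
    have z: "C1_compact (\<lambda>_. 0 :: real ^ 'n)" by (simp add: C1_compact_def C1_on_const)
    show ?thesis
      using calibrated_perturbation_le_perimeter[OF oO bO U(2,1) XC divX z pos(2) _ E, of 0] Xle by simp
  qed
  have adm: "\<exists>m>0. emeasure lebesgue E = ennreal m \<and> measure lebesgue E = m" if "cheeger_admissible \<Omega> E" for E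
  proof -
    have E: "E \<in> sets lebesgue" "E \<subseteq> \<Omega>" "emeasure lebesgue E > 0" using that by (auto simp: cheeger_admissible_def)
    have "E \<in> lmeasurable" using bounded_set_imp_lmeasurable[OF bounded_subset[OF bO E(2)] E(1)] .
    then have eq: "emeasure lebesgue E = ennreal (measure lebesgue E)" by (rule emeasure_eq_measure2)
    then have "measure lebesgue E > 0" using E(3) by simp
    then show ?thesis using eq by blast
  qed
  have admO: "cheeger_admissible \<Omega> \<Omega>"
  proof -
    have "\<not> negligible \<Omega>" using open_not_negligible[OF oO ne] .
    then show ?thesis using Om by (auto simp: cheeger_admissible_def negligible_iff_null_sets null_sets_def zero_less_iff_neq_zero)
  qed
  have ratio_ge: "ennreal (1 / c) \<le> perimeter E / emeasure lebesgue E" if E: "cheeger_admissible \<Omega> E" for E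
  proof -
    obtain m where m: "m > 0" "emeasure lebesgue E = ennreal m" "measure lebesgue E = m" using adm[OF E] by blast
    have "ennreal (m / c) \<le> perimeter E" using lower[of E] E m(3) by (simp add: cheeger_admissible_def)
    then have "ennreal (m / c) / ennreal m \<le> perimeter E / ennreal m" by (rule divide_right_mono_ennreal)
    moreover have "ennreal (m / c) / ennreal m = ennreal (1 / c)" using m(1) pos(2) by (simp add: divide_ennreal)
    ultimately show ?thesis using m(2) by simp
  qed
  have ratioO: "perimeter \<Omega> / emeasure lebesgue \<Omega> = ennreal (1 / c)"
  proof (rule antisym[OF _ ratio_ge[OF admO]])
    obtain m where m: "m > 0" "emeasure lebesgue \<Omega> = ennreal m" "measure lebesgue \<Omega> = m" using adm[OF admO] by blast
    have "perimeter \<Omega> / ennreal m \<le> ennreal (m / c) / ennreal m" using PO m(3) by (intro divide_right_mono_ennreal) simp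
    moreover have "ennreal (m / c) / ennreal m = ennreal (1 / c)" using m(1) pos(2) by (simp add: divide_ennreal)
    ultimately show "perimeter \<Omega> / emeasure lebesgue \<Omega> \<le> ennreal (1 / c)" using m(2) by simp
  qed
  have h1: "cheeger_constant \<Omega> = ennreal (1 / c)"
  proof (rule antisym)
    show "cheeger_constant \<Omega> \<le> ennreal (1 / c)"
      unfolding cheeger_constant_def using admO ratioO by (intro INF_lower2[of \<Omega>]) simp_all
    show "ennreal (1 / c) \<le> cheeger_constant \<Omega>"
      unfolding cheeger_constant_def by (rule INF_greatest) (simp add: ratio_ge)
  qed
  have "sym_diff E \<Omega> \<in> null_sets lebesgue" if min: "cheeger_minimizer \<Omega> E" for E
  proof -
    have aE: "cheeger_admissible \<Omega> E" and rE: "perimeter E / emeasure lebesgue E = ennreal (1 / c)"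
      using min h1 by (simp_all add: cheeger_minimizer_def)
    have E: "E \<in> sets lebesgue" "E \<subseteq> \<Omega>" "emeasure lebesgue E > 0" using aE by (auto simp: cheeger_admissible_def)
    obtain m where m: "m > 0" "emeasure lebesgue E = ennreal m" "measure lebesgue E = m" using adm[OF aE] by blast
    have P: "perimeter E \<le> ennreal (measure lebesgue E / c)"
    proof (cases "perimeter E")
      case (real p)
      have "ennreal (p / m) = ennreal (1 / c)" using rE m(1,2) real by (simp add: divide_ennreal)
      then have "p / m = 1 / c" using real(1) m(1) pos(2) by (simp add: ennreal_inj)
      then have "p = m / c" using m(1) pos(2) by (simp add: field_simps)
      then show ?thesis using real(2) m(3) by simp
    next
      case top
      then show ?thesis using rE m(2) by (simp add: ennreal_top_divide)
    qed
    have "weakly_constant_on \<Omega> E"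
      by (rule weakly_constant_on_if_perimeter_le[OF oO bO U(2,1) XC divX pos(2) Xle Xless E(1,2) P])
    from weakly_constant_on_connected[OF E(1) this oO \<Omega>(1)]
    have alt: "negligible (\<Omega> \<inter> E) \<or> negligible (\<Omega> - E)" .
    have "\<Omega> \<inter> E = E" using E(2) by blast
    moreover have "\<not> negligible E" using E(3) by (auto simp: negligible_iff_null_sets null_sets_def)
    ultimately have "negligible (\<Omega> - E)" using alt by simp
    moreover have "sym_diff E \<Omega> = \<Omega> - E" using E(2) by blast
    ultimately show ?thesis by (simp add: negligible_iff_null_sets)
  qed
  then show ?thesis using h1 ratioO admO by (simp add: cheeger_minimizer_def)
qed

end
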